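(* Let $X$ be a set, $\Lambda$ a uniform Banach space, $\mathcal{B}$ a $\Lambda$-valued RKBS on $X$ and $K$ its reproducing kernel. Then for all $x,y\in X$ and $\xi,\eta,\tau\in\Lambda$: (a) $[K(x,x)\xi,\xi]_\Lambda\ge0$ and $|[K(x,y)\xi,\eta]_\Lambda|\le[K(x,x)\xi,\xi]_\Lambda^{1/2}\,[K(y,y)\eta,\eta]_\Lambda^{1/2}$; (b) $\|K(x,y)\|_{\mathcal{M}(\Lambda)}\le\|K(x,x)\|_{\mathcal{M}(\Lambda)}^{1/2}\,\|K(y,y)\|_{\mathcal{M}(\Lambda)}^{1/2}$; (c) $K(x,\cdot)\xi=\mathcal{J}_{\mathcal{B}}^{-1}(\delta_x)^*\mathcal{J}_\Lambda(\xi)$, where $(\delta_x)^*:\Lambda^*\to\mathcal{B}^*$ is the adjoint of $\delta_x$; (d) $K(x,y)(\alpha\xi)=\alpha K(x,y)\xi$ for all $\alpha\in\mathbb{C}$; (e) $\|K(x,\cdot)\xi\|_{\mathcal{B}}\le\|\delta_x\|_{\mathcal{L}(\mathcal{B},\Lambda)}\|\xi\|_\Lambda$ and $\|K(x,\cdot)\xi\|_{\mathcal{B}}\le\|K(x,x)\|_{\mathcal{M}(\Lambda)}^{1/2}\|\xi\|_\Lambda$; (f) $(K(x,\cdot)\xi)^*+(K(x,\cdot)\eta)^*=(K(x,\cdot)\tau)^*$ whenever $\tau^*=\xi^*+\eta^*$; (g) $\operatorname{span}\{(K(x,\cdot)\xi)^*:x\in X,\ \xi\in\Lambda\}$ is dense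 in $\mathcal{B}^*$.
   Context: Banach spaces are over $\mathbb{C}$. A semi-inner product on a Banach space $V$ is a function $[\cdot,\cdot]_V:V\times V\to\mathbb{C}$ that is linear in its first variable, conjugate homogeneous in its second ($[f,\alpha g]_V=\overline{\alpha}[f,g]_V$), positive ($[f,f]_V>0$ for $f\neq0$), and satisfies $|[f,g]_V|\le[f,f]_V^{1/2}[g,g]_V^{1/2}$. It is compatible if $[f,f]_V^{1/2}=\|f\|_V$ for all $f\in V$. $V$ is uniformly convex if for all $\varepsilon>0$ there is $\delta>0$ with $\|f+g\|_V\le2-\delta$ whenever $\|f\|_V=\|g\|_V=1$ and $\|f-g\|_V\ge\varepsilon$. $V$ is uniformly Fréchet differentiable if $\lim_{t\in\mathbb{R},t\to0}(\|f+tg\|_V-\|f\|_V)/t$ exists uniformly over $f,g$ in the unit sphere of $V$. $V$ is called uniform if it is both uniformly convex and uniformly Fréchet differentiable. A uniform Banach space $V$ has a unique compatible semi-inner product, always denoted $[\cdot,\cdot]_V$; for $f\in V$, $f^*\in V^*$ is the functional $f^*(g)=[g,f]_V$, and the duality mapping $\mathcal{J}_V:V\to V^*$, $\mathcal{J}_V(f)=f^*$, is bijective and isometric (Giles). A Banach space of $\Lambda$-valued functions on $X$ is a Banach space $\mathcal{B}$ consisting of functions $X\to\Lambda$ such that $\|f\|_{\mathcal{B}}=0$ iff $f(x)=0$ for all $x\in X$. A $\Lambda$-valued RKBS on $X$ is a Banach space $\mathcal{B}$ of functions from $X$ to $\Lambda$, with both $\mathcal{B}$ and $\Lambda$ uniform,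 such that for every $x\in X$ the point evaluation $\delta_x:\mathcal{B}\to\Lambda$, $\delta_x(f)=f(x)$, is continuous. For Banach spaces $V_1,V_2$, $\mathcal{M}(V_1,V_2)$ is the set of all (not necessarily linear) maps $T:V_1\to V_2$ for which there is $\alpha\ge0$ with $\|Tu\|_{V_2}\le\alpha\|u\|_{V_1}$ for all $u\in V_1$; $\|T\|_{\mathcal{M}(V_1,V_2)}$ is the infimum of such $\alpha$. $\mathcal{M}(V):=\mathcal{M}(V,V)$, and $\mathcal{L}(V_1,V_2)$ is the subset of linear maps, with the operator norm. The reproducing kernel of $\mathcal{B}$ is the unique function $K:X\times X\to\mathcal{M}(\Lambda)$ such that $K(x,\cdot)\xi\in\mathcal{B}$ and $[f(x),\xi]_\Lambda=[f,K(x,\cdot)\xi]_{\mathcal{B}}$ for all $f\in\mathcal{B}$, $x\in X$, $\xi\in\Lambda$, where $K(x,\cdot)\xi$ denotes the function $y\mapsto K(x,y)\xi$. *)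

theory Defs
  imports "HOL-Analysis.Analysis" "HOL-Library.Function_Algebras"
begin

section \<open>Complex vector spaces\<close>

class complex_vector = ab_group_add +
  fixes scaleC :: "complex \<Rightarrow> 'a \<Rightarrow> 'a"  (infixr \<open>*\<^sub>C\<close> 75)
  assumes scaleC_add_right: "a *\<^sub>C (x + y) = a *\<^sub>C x + a *\<^sub>C y"
    and scaleC_add_left: "(a + b) *\<^sub>C x = a *\<^sub>C x + b *\<^sub>C x"
    and scaleC_scaleC: "a *\<^sub>C b *\<^sub>C x = (a * b) *\<^sub>C x"
    and scaleC_one: "1 *\<^sub>C x = x"

interpretation complex_vector: vector_space "scaleC :: complex \<Rightarrow> 'a \<Rightarrow> 'a::complex_vector"
  by unfold_locales (simp_all add: scaleC_add_right scaleC_add_left scaleC_scaleC scaleC_one)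

instantiation complex :: complex_vector
begin

definition scaleC_complex :: "complex \<Rightarrow> complex \<Rightarrow> complex"
  where "a *\<^sub>C z = a * z"

instance
  by standard (simp_all add: scaleC_complex_def algebra_simps)

end

instantiation "fun" :: (type, complex_vector) complex_vector
begin

definition scaleC_fun :: "complex \<Rightarrow> ('a \<Rightarrow> 'b) \<Rightarrow> 'a \<Rightarrow> 'b"
  where "a *\<^sub>C f = (\<lambda>x. a *\<^sub>C f x)"

instance
  by standard
    (simp_all add: scaleC_fun_def fun_eq_iff scaleC_add_right scaleC_add_left scaleC_scaleC scaleC_one)

end


section \<open>Functions on a set\<close>

text \<open>
  Throughout, a function on a set \<open>A\<close> is represented by its extension by zero to the whole type, so
  that the pointwise operations on the function type are the operations on such functions. This
  applies to the elements of function spaces on \<open>X\<close>, to operators and functionals on a normed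
  space, and to semi-inner products.
\<close>

definition funcset0 :: "'a set \<Rightarrow> 'b::zero set \<Rightarrow> ('a \<Rightarrow> 'b) set"
  where "funcset0 A S = {f. (\<forall>x\<in>A. f x \<in> S) \<and> (\<forall>x. x \<notin> A \<longrightarrow> f x = 0)}"

definition restrict0 :: "'a set \<Rightarrow> ('a \<Rightarrow> 'b::zero) \<Rightarrow> 'a \<Rightarrow> 'b"
  where "restrict0 A f = (\<lambda>x. if x \<in> A then f x else 0)"


section \<open>Banach spaces\<close>

text \<open>
  A normed space is a subspace \<open>carrier V\<close> of an ambient complex vector space together with a norm
  on it; the values of \<open>nrm V\<close> off the carrier are irrelevant.
\<close>

record 'v nspace =
  carrier :: "'v set"
  nrm :: "'v \<Rightarrow> real"

definition normed_space :: "'v::complex_vector nspace \<Rightarrow> bool"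
  where "normed_space V \<longleftrightarrow>
    complex_vector.subspace (carrier V) \<and>
    (\<forall>f\<in>carrier V. 0 \<le> nrm V f) \<and>
    (\<forall>f\<in>carrier V. nrm V f = 0 \<longleftrightarrow> f = 0) \<and>
    (\<forall>a. \<forall>f\<in>carrier V. nrm V (a *\<^sub>C f) = cmod a * nrm V f) \<and>
    (\<forall>f\<in>carrier V. \<forall>g\<in>carrier V. nrm V (f + g) \<le> nrm V f + nrm V g)"

text \<open>The locale \<open>Metric_space\<close> demands nonnegativity and symmetry off the carrier as well.\<close>

definition nspace_dist :: "'v::complex_vector nspace \<Rightarrow> 'v \<Rightarrow> 'v \<Rightarrow> real"
  where "nspace_dist V f g = (if f \<in> carrier V \<and> g \<in> carrier V then nrm V (f - g) else 0)"

lemma Metric_space_nspace: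
  assumes V: "normed_space V"
  shows "Metric_space (carrier V) (nspace_dist V)"
proof -
  have nonneg: "0 \<le> nrm V f" and zero: "nrm V f = 0 \<longleftrightarrow> f = 0"
    and scale: "nrm V (a *\<^sub>C f) = cmod a * nrm V f" if "f \<in> carrier V" for f a
    using V that by (simp_all add: normed_space_def)
  have triangle: "nrm V (f + g) \<le> nrm V f + nrm V g" if "f \<in> carrier V" "g \<in> carrier V" for f g
    using V that by (simp add: normed_space_def)
  have "complex_vector.subspace (carrier V)"
    using V by (simp add: normed_space_def)
  then have diff: "f - g \<in> carrier V" if "f \<in> carrier V" "g \<in> carrier V" for f g
    using that by (rule complex_vector.subspace_diff)
  show ?thesis
  proof (rule Metric_space.intro)
    show "0 \<le> nspace_dist V f g" for f g
      by (simp add: nspace_dist_def nonneg diff)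
    show "nspace_dist V f g = nspace_dist V g f" for f g
    proof (cases "f \<in> carrier V \<and> g \<in> carrier V")
      case True
      then have "nrm V ((- 1) *\<^sub>C (f - g)) = nrm V (f - g)"
        by (simp only: scale diff norm_minus_cancel norm_one mult_1_left)
      moreover have "(- 1) *\<^sub>C (f - g) = g - f"
        by (simp only: complex_vector.scale_minus_left scaleC_one minus_diff_eq)
      ultimately show ?thesis
        using True by (simp add: nspace_dist_def)
    qed (auto simp: nspace_dist_def)
    show "nspace_dist V f g = 0 \<longleftrightarrow> f = g" if "f \<in> carrier V" "g \<in> carrier V" for f g
      using that by (simp add: nspace_dist_def zero diff)
    show "nspace_dist V f h \<le> nspace_dist V f g + nspace_dist V g h"
      if "f \<in> carrier V" "g \<in> carrier V" "h \<in> carrier V" for f g h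
      using triangle[OF diff diff, of f g g h] that by (simp add: nspace_dist_def)
  qed
qed

definition nspace_topology :: "'v::complex_vector nspace \<Rightarrow> 'v topology"
  where "nspace_topology V = Metric_space.mtopology (carrier V) (nspace_dist V)"

definition banach_space :: "'v::complex_vector nspace \<Rightarrow> bool"
  where "banach_space V \<longleftrightarrow>
    normed_space V \<and> Metric_space.mcomplete (carrier V) (nspace_dist V)"

definition uniformly_convex :: "'v::complex_vector nspace \<Rightarrow> bool"
  where "uniformly_convex V \<longleftrightarrow>
    (\<forall>\<epsilon>>0. \<exists>\<delta>>0. \<forall>f\<in>carrier V. \<forall>g\<in>carrier V.
      nrm V f = 1 \<and> nrm V g = 1 \<and> nrm V (f - g) \<ge> \<epsilon> \<longrightarrow> nrm V (f + g) \<le> 2 - \<delta>)"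

definition unit_sphere :: "'v nspace \<Rightarrow> 'v set"
  where "unit_sphere V = {f \<in> carrier V. nrm V f = 1}"

definition uniformly_Frechet_differentiable :: "'v::complex_vector nspace \<Rightarrow> bool"
  where "uniformly_Frechet_differentiable V \<longleftrightarrow>
    (\<exists>G. uniform_limit (unit_sphere V \<times> unit_sphere V)
      (\<lambda>t (f, g). (nrm V (f + complex_of_real t *\<^sub>C g) - nrm V f) / t) G (at (0::real)))"

definition uniform_banach_space :: "'v::complex_vector nspace \<Rightarrow> bool"
  where "uniform_banach_space V \<longleftrightarrow>
    banach_space V \<and> uniformly_convex V \<and> uniformly_Frechet_differentiable V"


section \<open>Semi-inner products\<close>

definition semi_inner_product ::
    "'v::complex_vector nspace \<Rightarrow> ('v \<Rightarrow> 'v \<Rightarrow> complex) \<Rightarrow> bool"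
  where "semi_inner_product V s \<longleftrightarrow>
    (\<forall>f g. f \<notin> carrier V \<or> g \<notin> carrier V \<longrightarrow> s f g = 0) \<and>
    (\<forall>f\<in>carrier V. \<forall>g\<in>carrier V. \<forall>h\<in>carrier V. s (f + g) h = s f h + s g h) \<and>
    (\<forall>a. \<forall>f\<in>carrier V. \<forall>g\<in>carrier V. s (a *\<^sub>C f) g = a * s f g) \<and>
    (\<forall>a. \<forall>f\<in>carrier V. \<forall>g\<in>carrier V. s f (a *\<^sub>C g) = cnj a * s f g) \<and>
    (\<forall>f\<in>carrier V. f \<noteq> 0 \<longrightarrow> s f f \<in> \<real> \<and> 0 < Re (s f f)) \<and>
    (\<forall>f\<in>carrier V. \<forall>g\<in>carrier V. cmod (s f g) \<le> sqrt (Re (s f f)) * sqrt (Re (s g g)))"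

definition compatible :: "'v nspace \<Rightarrow> ('v \<Rightarrow> 'v \<Rightarrow> complex) \<Rightarrow> bool"
  where "compatible V s \<longleftrightarrow> (\<forall>f\<in>carrier V. sqrt (Re (s f f)) = nrm V f)"

text \<open>Meaningful for uniform Banach spaces, where existence and uniqueness hold by Giles' theorem.\<close>

definition sip :: "'v::complex_vector nspace \<Rightarrow> 'v \<Rightarrow> 'v \<Rightarrow> complex"
  where "sip V = (THE s. semi_inner_product V s \<and> compatible V s)"


section \<open>Operators and duality\<close>

definition bounded_maps :: "'v::complex_vector nspace \<Rightarrow> 'w::complex_vector nspace \<Rightarrow> ('v \<Rightarrow> 'w) set"
  where "bounded_maps V W =
    {T \<in> funcset0 (carrier V) (carrier W). \<exists>\<alpha>\<ge>0. \<forall>u\<in>carrier V. nrm W (T u) \<le> \<alpha> * nrm V u}"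

definition bounded_maps_norm ::
    "'v::complex_vector nspace \<Rightarrow> 'w::complex_vector nspace \<Rightarrow> ('v \<Rightarrow> 'w) \<Rightarrow> real"
  where "bounded_maps_norm V W T =
    Inf {\<alpha>. 0 \<le> \<alpha> \<and> (\<forall>u\<in>carrier V. nrm W (T u) \<le> \<alpha> * nrm V u)}"

definition bounded_ops ::
    "'v::complex_vector nspace \<Rightarrow> 'w::complex_vector nspace \<Rightarrow> ('v \<Rightarrow> 'w) nspace"
  where "bounded_ops V W =
    \<lparr>carrier = {T \<in> bounded_maps V W.
        (\<forall>u\<in>carrier V. \<forall>v\<in>carrier V. T (u + v) = T u + T v) \<and>
        (\<forall>a. \<forall>u\<in>carrier V. T (a *\<^sub>C u) = a *\<^sub>C T u)},
     nrm = (\<lambda>T. Sup {nrm W (T u) | u. u \<in> carrier V \<and> nrm V u \<le> 1})\<rparr>"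

definition complex_nspace :: "complex nspace"
  where "complex_nspace = \<lparr>carrier = UNIV, nrm = cmod\<rparr>"

definition dual :: "'v::complex_vector nspace \<Rightarrow> ('v \<Rightarrow> complex) nspace"
  where "dual V = bounded_ops V complex_nspace"

definition adjoint_map ::
    "'v::complex_vector nspace \<Rightarrow> 'w::complex_vector nspace \<Rightarrow> ('v \<Rightarrow> 'w) \<Rightarrow>
      ('w \<Rightarrow> complex) \<Rightarrow> 'v \<Rightarrow> complex"
  where "adjoint_map V W T =
    restrict0 (carrier (dual W)) (\<lambda>\<phi>. restrict0 (carrier V) (\<lambda>u. \<phi> (T u)))"

text \<open>\<open>duality_map V f\<close> is the functional \<open>f\<^sup>*\<close>.\<close>

definition duality_map :: "'v::complex_vector nspace \<Rightarrow> 'v \<Rightarrow> 'v \<Rightarrow> complex"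
  where "duality_map V f = restrict0 (carrier V) (\<lambda>g. sip V g f)"

definition duality_map_inv :: "'v::complex_vector nspace \<Rightarrow> ('v \<Rightarrow> complex) \<Rightarrow> 'v"
  where "duality_map_inv V = inv_into (carrier V) (duality_map V)"


section \<open>Reproducing kernel Banach spaces\<close>

definition banach_space_of_functions ::
    "'x set \<Rightarrow> 'l::complex_vector nspace \<Rightarrow> ('x \<Rightarrow> 'l) nspace \<Rightarrow> bool"
  where "banach_space_of_functions X \<Lambda> \<B> \<longleftrightarrow>
    banach_space \<B> \<and> carrier \<B> \<subseteq> funcset0 X (carrier \<Lambda>) \<and>
    (\<forall>f\<in>carrier \<B>. nrm \<B> f = 0 \<longleftrightarrow> (\<forall>x\<in>X. f x = 0))"

definition point_eval :: "('x \<Rightarrow> 'l::complex_vector) nspace \<Rightarrow> 'x \<Rightarrow> ('x \<Rightarrow> 'l) \<Rightarrow> 'l"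
  where "point_eval \<B> x = restrict0 (carrier \<B>) (\<lambda>f. f x)"

definition rkbs :: "'x set \<Rightarrow> 'l::complex_vector nspace \<Rightarrow> ('x \<Rightarrow> 'l) nspace \<Rightarrow> bool"
  where "rkbs X \<Lambda> \<B> \<longleftrightarrow>
    banach_space_of_functions X \<Lambda> \<B> \<and> uniform_banach_space \<B> \<and> uniform_banach_space \<Lambda> \<and>
    (\<forall>x\<in>X. continuous_map (nspace_topology \<B>) (nspace_topology \<Lambda>) (point_eval \<B> x))"

text \<open>\<open>kernel_section X K x \<xi>\<close> is the function \<open>K(x,\<cdot>)\<xi>\<close> on \<open>X\<close>.\<close>

definition kernel_section ::
    "'x set \<Rightarrow> ('x \<Rightarrow> 'x \<Rightarrow> 'l \<Rightarrow> 'l::complex_vector) \<Rightarrow> 'x \<Rightarrow> 'l \<Rightarrow> 'x \<Rightarrow> 'l"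
  where "kernel_section X K x \<xi> = restrict0 X (\<lambda>y. K x y \<xi>)"

text \<open>The values of \<open>K\<close> off \<open>X \<times> X\<close> are irrelevant.\<close>

definition reproducing_kernel ::
    "'x set \<Rightarrow> 'l::complex_vector nspace \<Rightarrow> ('x \<Rightarrow> 'l) nspace \<Rightarrow> ('x \<Rightarrow> 'x \<Rightarrow> 'l \<Rightarrow> 'l) \<Rightarrow> bool"
  where "reproducing_kernel X \<Lambda> \<B> K \<longleftrightarrow>
    (\<forall>x\<in>X. \<forall>y\<in>X. K x y \<in> bounded_maps \<Lambda> \<Lambda>) \<and>
    (\<forall>x\<in>X. \<forall>\<xi>\<in>carrier \<Lambda>. kernel_section X K x \<xi> \<in> carrier \<B> \<and>
      (\<forall>f\<in>carrier \<B>. sip \<Lambda> (f x) \<xi> = sip \<B> f (kernel_section X K x \<xi>)))"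

end

theory Submission
  imports Defs
begin

text \<open>
  The Gateaux derivative \<open>G f g\<close> of the norm at \<open>f\<close> in direction
  \<open>g\<close> is real linear in \<open>g\<close>, so
  \<open>\<parallel>f\<parallel> (G f g - \<i> G f (\<i> g))\<close> is a compatible
  semi-inner product, and differentiating \<open>Re [f + t g, f] \<le> \<parallel>f + t g\<parallel> \<parallel>f\<parallel>\<close>
  at \<open>t = 0\<close> shows that it is the only one. Everything but density is then Cauchy--Schwarz
  for \<open>[K(x,y)\<xi>, \<eta>] = [K(x,\<cdot>)\<xi>, K(y,\<cdot>)\<eta>]\<close> together with injectivity
  of the duality map, which comes from strict convexity. For density, a non-dense subspace of the dual
  has a nonzero common zero \<open>f\<close>; here \<open>[f(x), f(x)] = [f, K(x,\<cdot>)f(x)] = 0\<close>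
  for all \<open>x\<close>, so \<open>f = 0\<close>.
\<close>

section \<open>Normed spaces\<close>

text \<open>\<open>sip\<close> is a definite description, so not even Cauchy-Schwarz is available
  for it until exactly one compatible semi-inner product has been exhibited; hence the study of the
  norm's derivative. The shape of the candidate is forced: the real part of \<open>[g, f]\<close>
  must be the derivative at \<open>f\<close> of half the squared norm in direction \<open>g\<close>,
  and a complex linear functional is recovered from its real part R as R(g) - \<i> R(\<i> g). In the
  density step, the common zero is the point at which a shortest functional in a coset of the
  subspace would attain its norm. No limit of functionals is taken: only their almost norming
  vectors are followed, inside the space itself, where uniform convexity and completeness
  act.\<close>

locale complex_normed =
  fixes V :: "'v::complex_vector nspace"
  assumes normed: "normed_space V"
begin

lemma subspace_carrier: "complex_vector.subspace (carrier V)"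
  using normed by (simp add: normed_space_def)

lemmas zero_mem [simp] = complex_vector.subspace_0 [OF subspace_carrier]
  and add_mem [simp] = complex_vector.subspace_add [OF subspace_carrier]
  and diff_mem [simp] = complex_vector.subspace_diff [OF subspace_carrier]
  and scale_mem [simp] = complex_vector.subspace_scale [OF subspace_carrier]
  and neg_mem [simp] = complex_vector.subspace_neg [OF subspace_carrier]

lemma nrm_nonneg [simp]: "f \<in> carrier V \<Longrightarrow> 0 \<le> nrm V f"
  and nrm_eq_0 [simp]: "f \<in> carrier V \<Longrightarrow> nrm V f = 0 \<longleftrightarrow> f = 0"
  and nrm_scale [simp]: "f \<in> carrier V \<Longrightarrow> nrm V (a *\<^sub>C f) = cmod a * nrm V f"
  and nrm_triangle: "f \<in> carrier V \<Longrightarrow> g \<in> carrier V \<Longrightarrow> nrm V (f + g) \<le> nrm V f + nrm V g"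
  using normed by (simp_all add: normed_space_def)

lemma nrm_0 [simp]: "nrm V 0 = 0"
  by simp

lemma nrm_pos: "f \<in> carrier V \<Longrightarrow> f \<noteq> 0 \<Longrightarrow> 0 < nrm V f"
  using nrm_nonneg[of f] nrm_eq_0[of f] by linarith

lemma nrm_minus [simp]: "f \<in> carrier V \<Longrightarrow> nrm V (- f) = nrm V f"
  using nrm_scale[of f "-1"] by (simp add: complex_vector.scale_minus_left)

lemma nrm_diff_commute: "f \<in> carrier V \<Longrightarrow> g \<in> carrier V \<Longrightarrow> nrm V (f - g) = nrm V (g - f)"
  using nrm_minus[of "f - g"] by simp

lemma nrm_triangle_diff:
  assumes "f \<in> carrier V" "g \<in> carrier V"
  shows "\<bar>nrm V f - nrm V g\<bar> \<le> nrm V (f - g)"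
  using nrm_triangle[of "f - g" g] nrm_triangle[of "g - f" f] nrm_diff_commute[of f g] assms
  by simp

lemma nrm_normalize:
  assumes "f \<in> carrier V" "f \<noteq> 0"
  shows "nrm V (complex_of_real (1 / nrm V f) *\<^sub>C f) = 1"
  using assms nrm_pos[OF assms] by (simp add: norm_divide)

end


section \<open>The semi-inner product of a smooth normed space\<close>

text \<open>At \<open>t = 0\<close> division by zero gives 0, so the scaling rule and the bound
  below hold for every \<open>t\<close>.\<close>

definition diff_quotient :: "'v::complex_vector nspace \<Rightarrow> 'v \<Rightarrow> 'v \<Rightarrow> real \<Rightarrow> real"
  where "diff_quotient V f g t = (nrm V (f + complex_of_real t *\<^sub>C g) - nrm V f) / t"

definition Gateaux :: "'v::complex_vector nspace \<Rightarrow> 'v \<Rightarrow> 'v \<Rightarrow> real"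
  where "Gateaux V f g = Lim (at 0) (diff_quotient V f g)"

text \<open>The one complex linear functional with real part \<open>Gateaux V f\<close>, once the
  latter is known to be real linear.\<close>

definition complex_Gateaux :: "'v::complex_vector nspace \<Rightarrow> 'v \<Rightarrow> 'v \<Rightarrow> complex"
  where "complex_Gateaux V f g =
    complex_of_real (Gateaux V f g) - \<i> * complex_of_real (Gateaux V f (\<i> *\<^sub>C g))"

text \<open>At 0 the norm has no derivative in a nonzero direction; the value 0 at
  \<open>f = 0\<close> is the one that conjugate homogeneity forces.\<close>

definition Giles_sip :: "'v::complex_vector nspace \<Rightarrow> 'v \<Rightarrow> 'v \<Rightarrow> complex"
  where "Giles_sip V g f =
    (if g \<in> carrier V \<and> f \<in> carrier V \<and> f \<noteq> 0
     then complex_of_real (nrm V f) * complex_Gateaux V f g else 0)"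

text \<open>The filters are punctured, and \<open>c \<noteq> 0\<close> keeps \<open>c * t\<close>
  off 0; this licenses rescaling \<open>t\<close> inside a derivative.\<close>

lemma filterlim_mult_at_0:
  assumes "c \<noteq> (0::real)"
  shows "filterlim (\<lambda>t. c * t) (at 0) (at 0)"
  unfolding filterlim_at
  using assms by (auto intro!: tendsto_eq_intros simp: eventually_at_filter)

context complex_normed
begin

section \<open>Homogeneity and boundedness of difference quotients\<close>

lemma diff_quotient_scale:
  assumes "f \<in> carrier V" "g \<in> carrier V" "0 < a"
  shows "diff_quotient V (complex_of_real a *\<^sub>C f) (complex_of_real b *\<^sub>C g) t =
    b * diff_quotient V f g (b / a * t)"
proof -
  have "complex_of_real a *\<^sub>C f + complex_of_real t *\<^sub>C complex_of_real b *\<^sub>C g =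
      complex_of_real a *\<^sub>C (f + complex_of_real (b / a * t) *\<^sub>C g)"
    using assms by (simp add: scaleC_add_right scaleC_scaleC mult.commute)
  then have "nrm V (complex_of_real a *\<^sub>C f + complex_of_real t *\<^sub>C complex_of_real b *\<^sub>C g) =
      a * nrm V (f + complex_of_real (b / a * t) *\<^sub>C g)"
    using assms by simp
  moreover have "b = 0 \<Longrightarrow> ?thesis"
    using assms by (simp add: diff_quotient_def)
  ultimately show ?thesis
    using assms by (cases "b = 0") (simp_all add: diff_quotient_def flip: right_diff_distrib)
qed

lemma diff_quotient_bound:
  assumes "f \<in> carrier V" "g \<in> carrier V"
  shows "\<bar>diff_quotient V f g t\<bar> \<le> nrm V g"
proof (cases "t = 0")
  case False
  have "\<bar>nrm V (f + complex_of_real t *\<^sub>C g) - nrm V f\<bar> \<le> nrm V (complex_of_real t *\<^sub>C g)"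
    using nrm_triangle_diff[of "f + complex_of_real t *\<^sub>C g" f] assms by simp
  then show ?thesis
    using False assms by (simp add: diff_quotient_def abs_divide divide_le_eq mult.commute)
qed (use assms in \<open>simp add: diff_quotient_def\<close>)

end

locale smooth_normed = complex_normed +
  assumes smooth: "f \<in> carrier V \<Longrightarrow> f \<noteq> 0 \<Longrightarrow> g \<in> carrier V \<Longrightarrow>
    \<exists>L. (diff_quotient V f g \<longlongrightarrow> L) (at 0)"
begin

section \<open>Real linearity of the Gateaux derivative\<close>

lemma Gateaux_tendsto:
  assumes "f \<in> carrier V" "f \<noteq> 0" "g \<in> carrier V"
  shows "(diff_quotient V f g \<longlongrightarrow> Gateaux V f g) (at 0)"
  using smooth[OF assms] tendsto_Lim[of "at (0::real)" "diff_quotient V f g"]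
  by (auto simp: Gateaux_def)

lemma Gateaux_eqI:
  "(diff_quotient V f g \<longlongrightarrow> L) (at 0) \<Longrightarrow> Gateaux V f g = L"
  unfolding Gateaux_def by (intro tendsto_Lim) simp_all

lemma Gateaux_scale_real:
  assumes "f \<in> carrier V" "f \<noteq> 0" "g \<in> carrier V"
  shows "Gateaux V f (complex_of_real r *\<^sub>C g) = r * Gateaux V f g"
proof (rule Gateaux_eqI)
  have eq: "diff_quotient V f (complex_of_real r *\<^sub>C g) = (\<lambda>t. r * diff_quotient V f g (r * t))"
    using diff_quotient_scale[of f g 1 r] assms by (simp add: scaleC_one fun_eq_iff)
  show "(diff_quotient V f (complex_of_real r *\<^sub>C g) \<longlongrightarrow> r * Gateaux V f g) (at 0)"
  proof (cases "r = 0")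
    case False
    then show ?thesis
      unfolding eq
      by (intro tendsto_mult tendsto_const
          filterlim_compose[OF Gateaux_tendsto[OF assms] filterlim_mult_at_0])
  qed (unfold eq, simp)
qed

lemma Gateaux_neg:
  assumes "f \<in> carrier V" "f \<noteq> 0" "g \<in> carrier V"
  shows "Gateaux V f (- g) = - Gateaux V f g"
  using Gateaux_scale_real[OF assms, of "-1"]
  by (simp add: complex_vector.scale_minus_left scaleC_one)

text \<open>Convexity of the norm: \<open>f + t (g + h)\<close> is the midpoint of
  \<open>f + 2 t g\<close> and \<open>f + 2 t h\<close>. Dividing by \<open>t\<close> keeps the
  inequality only for \<open>t > 0\<close>, hence the limits from the right.\<close>

lemma Gateaux_subadd:
  assumes f: "f \<in> carrier V" "f \<noteq> 0" and g: "g \<in> carrier V" and h: "h \<in> carrier V"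
  shows "Gateaux V f (g + h) \<le> Gateaux V f g + Gateaux V f h"
proof (rule tendsto_le)
  have lim2: "((\<lambda>t. diff_quotient V f k (2 * t)) \<longlongrightarrow> Gateaux V f k) (at_right 0)"
    if "k \<in> carrier V" for k
    using filterlim_compose[OF Gateaux_tendsto[OF f that] filterlim_mult_at_0[of 2]]
    by (simp add: filterlim_at_split)
  show "((\<lambda>t. diff_quotient V f g (2 * t) + diff_quotient V f h (2 * t)) \<longlongrightarrow>
      Gateaux V f g + Gateaux V f h) (at_right 0)"
    by (intro tendsto_add lim2 g h)
  show "(diff_quotient V f (g + h) \<longlongrightarrow> Gateaux V f (g + h)) (at_right 0)"
    using Gateaux_tendsto[OF f, of "g + h"] g h by (simp add: filterlim_at_split)
  have "diff_quotient V f (g + h) t \<le> diff_quotient V f g (2 * t) + diff_quotient V f h (2 * t)"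
    if "0 < t" for t
  proof -
    let ?a = "f + complex_of_real (2 * t) *\<^sub>C g" and ?b = "f + complex_of_real (2 * t) *\<^sub>C h"
    have "(2 :: complex) *\<^sub>C (f + complex_of_real t *\<^sub>C (g + h)) = ?a + ?b"
      using scaleC_add_left[of 1 1 f]
      by (simp add: scaleC_add_right scaleC_scaleC scaleC_one algebra_simps)
    then have "2 * nrm V (f + complex_of_real t *\<^sub>C (g + h)) = nrm V (?a + ?b)"
      using nrm_scale[of "f + complex_of_real t *\<^sub>C (g + h)" 2] f g h by simp
    also have "\<dots> \<le> nrm V ?a + nrm V ?b"
      using f g h by (intro nrm_triangle) simp_all
    finally have "(nrm V (f + complex_of_real t *\<^sub>C (g + h)) - nrm V f) / t \<le>
        ((nrm V ?a - nrm V f) + (nrm V ?b - nrm V f)) / 2 / t"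
      using that by (intro divide_right_mono) simp_all
    then show ?thesis
      by (simp only: diff_quotient_def add_divide_distrib divide_divide_eq_left mult.commute)
  qed
  then show "\<forall>\<^sub>F t in at_right 0.
      diff_quotient V f (g + h) t \<le> diff_quotient V f g (2 * t) + diff_quotient V f h (2 * t)"
    by (simp add: eventually_at_filter)
qed simp

text \<open>An odd subadditive function is additive: subadditivity at \<open>- g\<close> and
  \<open>- h\<close> is the reverse inequality.\<close>

lemma Gateaux_add:
  assumes f: "f \<in> carrier V" "f \<noteq> 0" and g: "g \<in> carrier V" and h: "h \<in> carrier V"
  shows "Gateaux V f (g + h) = Gateaux V f g + Gateaux V f h"
proof (rule antisym)
  have "Gateaux V f (- g + - h) \<le> Gateaux V f (- g) + Gateaux V f (- h)"
    using assms by (intro Gateaux_subadd) simp_all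
  moreover have "Gateaux V f (- g + - h) = - Gateaux V f (g + h)"
    using Gateaux_neg[OF f, of "g + h"] g h by simp
  ultimately show "Gateaux V f g + Gateaux V f h \<le> Gateaux V f (g + h)"
    using assms by (simp add: Gateaux_neg)
qed (rule Gateaux_subadd[OF assms])

lemma Gateaux_bound:
  assumes "f \<in> carrier V" "f \<noteq> 0" "g \<in> carrier V"
  shows "\<bar>Gateaux V f g\<bar> \<le> nrm V g"
  using tendsto_rabs[OF Gateaux_tendsto[OF assms]]
  by (rule tendsto_upperbound) (use diff_quotient_bound assms in simp_all)

lemma Gateaux_self:
  assumes f: "f \<in> carrier V" "f \<noteq> 0"
  shows "Gateaux V f f = nrm V f"
proof (rule Gateaux_eqI, rule tendsto_eventually)
  \<comment> \<open>For \<open>t > -1\<close> the scalar \<open>1 + t\<close> is its own modulus, so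
    the quotient is constant near 0.\<close>
  have "diff_quotient V f f t = nrm V f" if "-1 < t" "t \<noteq> 0" for t
  proof -
    have "f + complex_of_real t *\<^sub>C f = complex_of_real (1 + t) *\<^sub>C f"
      by (simp add: scaleC_add_left scaleC_one)
    then show ?thesis
      using f that by (simp add: diff_quotient_def field_simps del: of_real_add)
  qed
  moreover have "\<forall>\<^sub>F t in at (0::real). -1 < t"
    by (rule order_tendstoD[OF tendsto_ident_at]) simp
  ultimately show "\<forall>\<^sub>F t in at 0. diff_quotient V f f t = nrm V f"
    by (auto simp: eventually_at_filter elim: eventually_mono)
qed

lemma Gateaux_scale_base:
  assumes f: "f \<in> carrier V" "f \<noteq> 0" and g: "g \<in> carrier V" and a: "a \<noteq> 0"
  shows "Gateaux V (a *\<^sub>C f) g = cmod a * Gateaux V f (inverse a *\<^sub>C g)"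
proof (rule Gateaux_eqI)
  have "diff_quotient V (a *\<^sub>C f) g t = cmod a * diff_quotient V f (inverse a *\<^sub>C g) t" for t
  proof -
    have "a *\<^sub>C f + complex_of_real t *\<^sub>C g = a *\<^sub>C (f + complex_of_real t *\<^sub>C inverse a *\<^sub>C g)"
      using a by (simp add: scaleC_add_right scaleC_scaleC)
    then have "nrm V (a *\<^sub>C f + complex_of_real t *\<^sub>C g) =
        cmod a * nrm V (f + complex_of_real t *\<^sub>C inverse a *\<^sub>C g)"
      using f g by simp
    then show ?thesis
      using f by (simp add: diff_quotient_def right_diff_distrib)
  qed
  then have "diff_quotient V (a *\<^sub>C f) g = (\<lambda>t. cmod a * diff_quotient V f (inverse a *\<^sub>C g) t)"
    by blast
  then show "(diff_quotient V (a *\<^sub>C f) g \<longlongrightarrow> cmod a * Gateaux V f (inverse a *\<^sub>C g)) (at 0)"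
    using tendsto_mult[OF tendsto_const[of "cmod a"] Gateaux_tendsto[OF f, of "inverse a *\<^sub>C g"]] g
    by simp
qed

section \<open>Complex linearity and bounds\<close>

lemma complex_Gateaux_add:
  assumes "f \<in> carrier V" "f \<noteq> 0" "g \<in> carrier V" "h \<in> carrier V"
  shows "complex_Gateaux V f (g + h) = complex_Gateaux V f g + complex_Gateaux V f h"
  using assms by (simp add: complex_Gateaux_def Gateaux_add scaleC_add_right algebra_simps)

text \<open>Real scalars and \<open>\<i>\<close> suffice. Multiplying by \<open>\<i>\<close>
  exchanges the two Gateaux terms up to sign, because applying \<open>\<i>\<close> twice to
  \<open>g\<close> gives \<open>- g\<close>.\<close>

lemma complex_Gateaux_scale:
  assumes f: "f \<in> carrier V" "f \<noteq> 0" and g: "g \<in> carrier V"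
  shows "complex_Gateaux V f (a *\<^sub>C g) = a * complex_Gateaux V f g"
proof -
  have re: "complex_Gateaux V f (complex_of_real r *\<^sub>C h) = complex_of_real r * complex_Gateaux V f h"
    if h: "h \<in> carrier V" for r h
  proof -
    have "\<i> *\<^sub>C complex_of_real r *\<^sub>C h = complex_of_real r *\<^sub>C \<i> *\<^sub>C h"
      by (simp add: mult.commute)
    then have "Gateaux V f (\<i> *\<^sub>C complex_of_real r *\<^sub>C h) = r * Gateaux V f (\<i> *\<^sub>C h)"
      by (simp only: Gateaux_scale_real[OF f scale_mem[OF h]])
    then show ?thesis
      unfolding complex_Gateaux_def Gateaux_scale_real[OF f h]
      by (simp only: of_real_mult right_diff_distrib mult.left_commute)
  qed
  have im: "complex_Gateaux V f (\<i> *\<^sub>C g) = \<i> * complex_Gateaux V f g"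
  proof -
    have "\<i> *\<^sub>C \<i> *\<^sub>C g = - g"
      by (simp add: complex_vector.scale_minus_left scaleC_one)
    then have "Gateaux V f (\<i> *\<^sub>C \<i> *\<^sub>C g) = - Gateaux V f g"
      by (simp only: Gateaux_neg[OF f g])
    then show ?thesis
      unfolding complex_Gateaux_def by (simp add: right_diff_distrib)
  qed
  have "a *\<^sub>C g = (complex_of_real (Re a) + complex_of_real (Im a) * \<i>) *\<^sub>C g"
    using complex_eq[of a] by (simp only: mult.commute)
  also have "\<dots> = complex_of_real (Re a) *\<^sub>C g + complex_of_real (Im a) *\<^sub>C \<i> *\<^sub>C g"
    by (simp only: scaleC_add_left scaleC_scaleC)
  finally have "complex_Gateaux V f (a *\<^sub>C g) =
      (complex_of_real (Re a) + complex_of_real (Im a) * \<i>) * complex_Gateaux V f g"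
    using complex_Gateaux_add[OF f scale_mem[OF g] scale_mem[OF scale_mem[OF g]]]
    by (simp only: re[OF g] re[OF scale_mem[OF g]] im distrib_right mult.assoc)
  also have "complex_of_real (Re a) + complex_of_real (Im a) * \<i> = a"
    using complex_eq[of a] by (simp only: mult.commute)
  finally show ?thesis .
qed

lemma complex_Gateaux_bound:
  assumes f: "f \<in> carrier V" "f \<noteq> 0" and g: "g \<in> carrier V"
  shows "cmod (complex_Gateaux V f g) \<le> nrm V g"
proof (cases "complex_Gateaux V f g = 0")
  case False
  define z where "z = complex_Gateaux V f g"
  \<comment> \<open>A unimodular factor that turns the value into its modulus, so that the real
    derivative in direction \<open>u *\<^sub>C g\<close> carries all of it.\<close>
  define u where "u = complex_of_real (cmod z) / z"
  have u: "cmod u = 1" "u * z = complex_of_real (cmod z)"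
    using False by (simp_all add: u_def z_def norm_divide)
  have "complex_Gateaux V f (u *\<^sub>C g) = complex_of_real (cmod z)"
    using f g u(2) by (simp add: complex_Gateaux_scale z_def)
  then have "Gateaux V f (u *\<^sub>C g) = cmod z"
    by (simp add: complex_Gateaux_def complex_eq_iff)
  then show ?thesis
    using Gateaux_bound[OF f, of "u *\<^sub>C g"] g u(1) by (simp add: z_def)
qed (use g in simp)

text \<open>The real part already exhausts the bound \<open>nrm V f\<close> on the modulus, which
  leaves no room for an imaginary part.\<close>

lemma complex_Gateaux_self:
  assumes f: "f \<in> carrier V" "f \<noteq> 0"
  shows "complex_Gateaux V f f = complex_of_real (nrm V f)"
proof -
  have re: "Re (complex_Gateaux V f f) = nrm V f"
    using Gateaux_self[OF f] by (simp add: complex_Gateaux_def)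
  have "(cmod (complex_Gateaux V f f))\<^sup>2 \<le> (nrm V f)\<^sup>2"
    using complex_Gateaux_bound[OF f f(1)] by (simp add: power_mono)
  then have "Im (complex_Gateaux V f f) = 0"
    by (simp add: cmod_power2 re)
  then show ?thesis
    using re by (simp add: complex_eq_iff)
qed

text \<open>The factor \<open>cmod a / a\<close>, times the \<open>cmod a\<close> coming from the
  norm of the scaled base point, is \<open>cnj a\<close>: the source of conjugate
  homogeneity.\<close>

lemma complex_Gateaux_scale_base:
  assumes f: "f \<in> carrier V" "f \<noteq> 0" and g: "g \<in> carrier V" and a: "a \<noteq> 0"
  shows "complex_Gateaux V (a *\<^sub>C f) g = complex_of_real (cmod a) / a * complex_Gateaux V f g"
proof -
  have "inverse a *\<^sub>C \<i> *\<^sub>C g = \<i> *\<^sub>C inverse a *\<^sub>C g"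
    by (simp add: scaleC_scaleC mult.commute)
  then have "complex_Gateaux V (a *\<^sub>C f) g =
      complex_of_real (cmod a) * complex_Gateaux V f (inverse a *\<^sub>C g)"
    using assms by (simp add: complex_Gateaux_def Gateaux_scale_base algebra_simps)
  then show ?thesis
    using f g by (simp add: complex_Gateaux_scale divide_inverse)
qed

section \<open>Existence and uniqueness of the compatible semi-inner product\<close>

lemma semi_inner_product_Giles: "semi_inner_product V (Giles_sip V)"
  and compatible_Giles: "compatible V (Giles_sip V)"
proof -
  have self: "Giles_sip V f f = complex_of_real ((nrm V f)\<^sup>2)" if "f \<in> carrier V" for f
    using that by (cases "f = 0") (simp_all add: Giles_sip_def complex_Gateaux_self power2_eq_square)
  have bound: "cmod (Giles_sip V f g) \<le> nrm V f * nrm V g"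
    if "f \<in> carrier V" "g \<in> carrier V" for f g
    using that complex_Gateaux_bound[of g f]
      mult_left_mono[of "cmod (complex_Gateaux V g f)" "nrm V f" "nrm V g"]
    by (cases "g = 0") (auto simp: Giles_sip_def norm_mult mult.commute)
  have cnj: "Giles_sip V f (a *\<^sub>C g) = cnj a * Giles_sip V f g"
    if "f \<in> carrier V" "g \<in> carrier V" for a f g
  proof (cases "a = 0 \<or> g = 0")
    case False
    then have "complex_of_real (cmod a) * (complex_of_real (cmod a) / a) = cnj a"
      using complex_norm_square[of a] by (simp add: power2_eq_square)
    moreover have "Giles_sip V f (a *\<^sub>C g) =
        complex_of_real (cmod a) * (complex_of_real (cmod a) / a) * Giles_sip V f g"
      using False that by (simp add: Giles_sip_def complex_Gateaux_scale_base)
    ultimately show ?thesis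
      by simp
  qed (auto simp: Giles_sip_def)
  show "compatible V (Giles_sip V)"
    by (simp add: compatible_def self)
  show "semi_inner_product V (Giles_sip V)"
    unfolding semi_inner_product_def
  proof (intro conjI allI ballI impI)
    fix f g h a
    assume f: "f \<in> carrier V"
    show "Giles_sip V f f \<in> \<real>"
      using f by (simp add: self)
    show "f \<noteq> 0 \<Longrightarrow> 0 < Re (Giles_sip V f f)"
      using nrm_pos[OF f] f by (simp add: self)
    assume g: "g \<in> carrier V"
    show "Giles_sip V (a *\<^sub>C f) g = a * Giles_sip V f g"
      using f g by (simp add: Giles_sip_def complex_Gateaux_scale)
    show "Giles_sip V f (a *\<^sub>C g) = cnj a * Giles_sip V f g"
      by (rule cnj[OF f g])
    show "cmod (Giles_sip V f g) \<le> sqrt (Re (Giles_sip V f f)) * sqrt (Re (Giles_sip V g g))"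
      using bound[OF f g] f g by (simp add: self)
    assume h: "h \<in> carrier V"
    show "Giles_sip V (f + g) h = Giles_sip V f h + Giles_sip V g h"
      using f g h by (simp add: Giles_sip_def complex_Gateaux_add algebra_simps)
  qed (auto simp: Giles_sip_def)
qed

lemma Re_compatible_sip:
  assumes s: "semi_inner_product V s" "compatible V s"
    and f: "f \<in> carrier V" "f \<noteq> 0" and g: "g \<in> carrier V"
  shows "Re (s g f) = nrm V f * Gateaux V f g"
proof -
  have nrm: "sqrt (Re (s k k)) = nrm V k" if "k \<in> carrier V" for k
    using s(2) that by (simp add: compatible_def)
  have Re_self: "Re (s f f) = (nrm V f)\<^sup>2"
  proof -
    have "0 < Re (s f f)"
      using s(1) f by (simp add: semi_inner_product_def)
    then show ?thesis
      by (simp flip: nrm[OF f(1)])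
  qed
  have le: "nrm V f * nrm V f + t * Re (s g f) \<le> nrm V (f + complex_of_real t *\<^sub>C g) * nrm V f" for t
  proof -
    have "s (f + complex_of_real t *\<^sub>C g) f = s f f + complex_of_real t * s g f"
      using s(1) f g by (simp add: semi_inner_product_def)
    then have "nrm V f * nrm V f + t * Re (s g f) = Re (s (f + complex_of_real t *\<^sub>C g) f)"
      by (simp add: Re_self power2_eq_square)
    also have "\<dots> \<le> cmod (s (f + complex_of_real t *\<^sub>C g) f)"
      by (rule complex_Re_le_cmod)
    also have "\<dots> \<le> nrm V (f + complex_of_real t *\<^sub>C g) * nrm V f"
    proof -
      have "cmod (s h f) \<le> sqrt (Re (s h h)) * sqrt (Re (s f f))" if "h \<in> carrier V" for h
        using s(1) f that by (simp add: semi_inner_product_def)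
      then show ?thesis
        using f g by (simp add: nrm)
    qed
    finally show ?thesis .
  qed
  have lim: "((\<lambda>t. nrm V f * diff_quotient V f g t) \<longlongrightarrow> nrm V f * Gateaux V f g) (at 0)"
    by (intro tendsto_mult tendsto_const Gateaux_tendsto f g)
  \<comment> \<open>Both sides of \<open>le\<close> agree at \<open>t = 0\<close>. Subtracting and
    dividing by \<open>t\<close> preserves the inequality for \<open>t > 0\<close> and reverses it
    for \<open>t < 0\<close>, so the one-sided limits enclose \<open>Re (s g f)\<close>.\<close>
  show ?thesis
  proof (rule antisym)
    show "Re (s g f) \<le> nrm V f * Gateaux V f g"
    proof (rule tendsto_lowerbound)
      show "((\<lambda>t. nrm V f * diff_quotient V f g t) \<longlongrightarrow> nrm V f * Gateaux V f g) (at_right 0)"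
        using lim by (simp add: filterlim_at_split)
      have "Re (s g f) \<le> nrm V f * diff_quotient V f g t" if "0 < t" for t
        using le[of t] that by (simp add: diff_quotient_def field_simps)
      then show "\<forall>\<^sub>F t in at_right 0. Re (s g f) \<le> nrm V f * diff_quotient V f g t"
        by (simp add: eventually_at_filter)
    qed simp
    show "nrm V f * Gateaux V f g \<le> Re (s g f)"
    proof (rule tendsto_upperbound)
      show "((\<lambda>t. nrm V f * diff_quotient V f g t) \<longlongrightarrow> nrm V f * Gateaux V f g) (at_left 0)"
        using lim by (simp add: filterlim_at_split)
      have "nrm V f * diff_quotient V f g t \<le> Re (s g f)" if "t < 0" for t
        using le[of t] that by (simp add: diff_quotient_def field_simps)
      then show "\<forall>\<^sub>F t in at_left 0. nrm V f * diff_quotient V f g t \<le> Re (s g f)"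
        by (simp add: eventually_at_filter)
    qed simp
  qed
qed

text \<open>The norm fixes the real part, and the direction \<open>\<i> *\<^sub>C g\<close> then
  fixes the imaginary part. Values off the carrier are 0 by convention, those at
  \<open>f = 0\<close> by conjugate homogeneity with scalar 0.\<close>

lemma compatible_sip_unique:
  assumes s: "semi_inner_product V s" "compatible V s"
  shows "s = Giles_sip V"
proof (intro ext)
  fix g f
  show "s g f = Giles_sip V g f"
  proof (cases "g \<in> carrier V \<and> f \<in> carrier V \<and> f \<noteq> 0")
    case True
    then have f: "f \<in> carrier V" "f \<noteq> 0" and g: "g \<in> carrier V" by auto
    have "s (\<i> *\<^sub>C g) f = \<i> * s g f"
      using s(1) f g by (simp add: semi_inner_product_def)
    then have "Re (s (\<i> *\<^sub>C g) f) = - Im (s g f)"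
      by simp
    then show ?thesis
      using Re_compatible_sip[OF s f g] Re_compatible_sip[OF s f, of "\<i> *\<^sub>C g"] f g
      by (simp add: Giles_sip_def complex_Gateaux_def complex_eq_iff)
  next
    case False
    have "s g 0 = 0" if "g \<in> carrier V"
    proof -
      have "s g (0 *\<^sub>C 0) = cnj 0 * s g 0"
        using s(1) that zero_mem unfolding semi_inner_product_def by blast
      then show ?thesis by simp
    qed
    then show ?thesis
      using False s(1) by (auto simp: Giles_sip_def semi_inner_product_def)
  qed
qed

lemma sip_eq_Giles_sip: "sip V = Giles_sip V"
  unfolding sip_def
  by (rule the_equality) (use semi_inner_product_Giles compatible_Giles compatible_sip_unique in blast)+

lemma semi_inner_product_sip: "semi_inner_product V (sip V)"
  and compatible_sip: "compatible V (sip V)"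
  by (simp_all add: sip_eq_Giles_sip semi_inner_product_Giles compatible_Giles)

lemma sip_add: "f \<in> carrier V \<Longrightarrow> g \<in> carrier V \<Longrightarrow> h \<in> carrier V \<Longrightarrow>
    sip V (f + g) h = sip V f h + sip V g h"
  and sip_scale: "f \<in> carrier V \<Longrightarrow> g \<in> carrier V \<Longrightarrow> sip V (a *\<^sub>C f) g = a * sip V f g"
  and sip_scale_right: "f \<in> carrier V \<Longrightarrow> g \<in> carrier V \<Longrightarrow> sip V f (a *\<^sub>C g) = cnj a * sip V f g"
  using semi_inner_product_sip by (simp_all add: semi_inner_product_def)

lemma sip_self: "f \<in> carrier V \<Longrightarrow> sip V f f = complex_of_real ((nrm V f)\<^sup>2)"
  by (cases "f = 0") (simp_all add: sip_eq_Giles_sip Giles_sip_def complex_Gateaux_self power2_eq_square)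

lemma sip_bound: "f \<in> carrier V \<Longrightarrow> g \<in> carrier V \<Longrightarrow> cmod (sip V f g) \<le> nrm V f * nrm V g"
  using semi_inner_product_sip compatible_sip
  by (simp add: semi_inner_product_def compatible_def)

end


section \<open>Uniform Banach spaces\<close>

locale uniform_normed = complex_normed +
  assumes uniform: "uniform_banach_space V"
begin

sublocale smooth_normed
proof
  fix f g
  assume f: "f \<in> carrier V" "f \<noteq> 0" and g: "g \<in> carrier V"
  show "\<exists>L. (diff_quotient V f g \<longlongrightarrow> L) (at 0)"
  proof (cases "g = 0")
    case True
    then have "diff_quotient V f g = (\<lambda>t. 0)"
      by (simp add: diff_quotient_def fun_eq_iff)
    then show ?thesis
      by (auto intro: tendsto_const)
  next
    case False
    \<comment> \<open>The uniform limit concerns unit vectors; homogeneity carries it to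
      \<open>f\<close> and \<open>g\<close> at the cost of the factor
      \<open>nrm V g / nrm V f\<close> on \<open>t\<close>.\<close>
    define f0 where "f0 = complex_of_real (1 / nrm V f) *\<^sub>C f"
    define g0 where "g0 = complex_of_real (1 / nrm V g) *\<^sub>C g"
    have pos: "0 < nrm V f" "0 < nrm V g"
      using f g False by (simp_all add: nrm_pos)
    have mem: "f0 \<in> carrier V" "g0 \<in> carrier V"
      using f g by (simp_all add: f0_def g0_def)
    have f_eq: "f = complex_of_real (nrm V f) *\<^sub>C f0" and g_eq: "g = complex_of_real (nrm V g) *\<^sub>C g0"
      using pos by (simp_all add: f0_def g0_def scaleC_one)
    have eq: "diff_quotient V f g = (\<lambda>t. nrm V g * diff_quotient V f0 g0 (nrm V g / nrm V f * t))"
    proof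
      show "diff_quotient V f g t = nrm V g * diff_quotient V f0 g0 (nrm V g / nrm V f * t)" for t
        using diff_quotient_scale[OF mem pos(1), of "nrm V g" t] by (simp flip: f_eq g_eq)
    qed
    obtain G where G: "uniform_limit (unit_sphere V \<times> unit_sphere V)
        (\<lambda>t (f, g). (nrm V (f + complex_of_real t *\<^sub>C g) - nrm V f) / t) G (at (0::real))"
      using uniform by (auto simp: uniform_banach_space_def uniformly_Frechet_differentiable_def)
    have "(f0, g0) \<in> unit_sphere V \<times> unit_sphere V"
      using mem nrm_normalize f g False by (simp add: unit_sphere_def f0_def g0_def)
    from tendsto_uniform_limitI[OF G this]
    have "(diff_quotient V f0 g0 \<longlongrightarrow> G (f0, g0)) (at 0)"
      by (simp add: diff_quotient_def[abs_def])
    then have "((\<lambda>t. nrm V g * diff_quotient V f0 g0 (nrm V g / nrm V f * t)) \<longlongrightarrow>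
        nrm V g * G (f0, g0)) (at 0)"
      using pos by (intro tendsto_mult tendsto_const filterlim_compose[OF _ filterlim_mult_at_0]) simp_all
    then show ?thesis
      using eq by auto
  qed
qed

section \<open>Strict convexity and injectivity of the duality mapping\<close>

lemma duality_map_apply [simp]: "g \<in> carrier V \<Longrightarrow> duality_map V f g = sip V g f"
  by (simp add: duality_map_def restrict0_def)

text \<open>Strict convexity, from uniform convexity with \<epsilon> the distance of
  \<open>f\<close> and \<open>g\<close> after scaling to the unit sphere: if they differed, their
  sum would fall short of the maximal norm by a definite amount.\<close>

lemma eq_of_nrm_midpoint:
  assumes f: "f \<in> carrier V" and g: "g \<in> carrier V"
    and nrm: "nrm V g = nrm V f" "2 * nrm V f \<le> nrm V (f + g)"
  shows "f = g"
proof (rule ccontr)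
  assume "f \<noteq> g"
  then have "0 < nrm V f"
    using f g nrm(1) nrm_pos[of f] nrm_pos[of g] by (cases "f = 0") auto
  define c where "c = complex_of_real (1 / nrm V f)"
  have c: "cmod c = 1 / nrm V f"
    using \<open>0 < nrm V f\<close> by (simp add: c_def norm_divide)
  have "0 < nrm V (f - g) / nrm V f"
    using \<open>f \<noteq> g\<close> f g \<open>0 < nrm V f\<close> by (simp add: nrm_pos)
  then obtain \<delta> where "0 < \<delta>" and \<delta>: "\<And>f' g'. f' \<in> carrier V \<Longrightarrow> g' \<in> carrier V \<Longrightarrow> nrm V f' = 1 \<Longrightarrow>
      nrm V g' = 1 \<Longrightarrow> nrm V (f - g) / nrm V f \<le> nrm V (f' - g') \<Longrightarrow> nrm V (f' + g') \<le> 2 - \<delta>"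
    using uniform unfolding uniform_banach_space_def uniformly_convex_def by blast
  have "nrm V (c *\<^sub>C f + c *\<^sub>C g) \<le> 2 - \<delta>"
  proof (rule \<delta>)
    show "nrm V (f - g) / nrm V f \<le> nrm V (c *\<^sub>C f - c *\<^sub>C g)"
      using f g c by (simp flip: complex_vector.scale_right_diff_distrib)
  qed (use f g c nrm(1) \<open>0 < nrm V f\<close> in \<open>auto simp: norm_mult\<close>)
  then have "nrm V (f + g) / nrm V f \<le> 2 - \<delta>"
    using f g c by (simp flip: scaleC_add_right)
  then have "nrm V (f + g) \<le> 2 * nrm V f - \<delta> * nrm V f"
    using \<open>0 < nrm V f\<close> by (simp add: pos_divide_le_eq left_diff_distrib)
  moreover have "0 < \<delta> * nrm V f"
    using \<open>0 < \<delta>\<close> \<open>0 < nrm V f\<close> by simp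
  ultimately show False
    using nrm(2) by linarith
qed

text \<open>Equal functionals force equal norms, by testing each on the other's vector, and then
  \<open>[f + g, f]\<close> equals twice the squared norm of \<open>f\<close>; by Cauchy-Schwarz the
  sum has maximal norm.\<close>

lemma inj_on_duality_map: "inj_on (duality_map V) (carrier V)"
proof
  fix f g
  assume f: "f \<in> carrier V" and g: "g \<in> carrier V" and "duality_map V f = duality_map V g"
  then have eq: "sip V h f = sip V h g" if "h \<in> carrier V" for h
    using duality_map_apply[OF that] by metis
  have le: "nrm V a \<le> nrm V b" if "a \<in> carrier V" "b \<in> carrier V" "sip V a a = sip V a b" for a b
  proof (cases "a = 0")
    case False
    have "cmod (sip V a b) = nrm V a * nrm V a"
      unfolding that(3)[symmetric] sip_self[OF that(1)] by (simp add: norm_mult power2_eq_square)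
    then have "nrm V a * nrm V a \<le> nrm V a * nrm V b"
      using sip_bound[OF that(1,2)] by simp
    then show ?thesis
      using nrm_pos[OF that(1) False] by simp
  qed (use that in simp)
  have nrm: "nrm V g = nrm V f"
    using le[OF f g eq[OF f]] le[OF g f eq[OF g, symmetric]] by (rule antisym[rotated])
  have "sip V (f + g) f = 2 * complex_of_real (nrm V f * nrm V f)"
    using f g eq[OF g] by (simp add: sip_add sip_self nrm power2_eq_square)
  then have "2 * (nrm V f * nrm V f) \<le> nrm V (f + g) * nrm V f"
    using sip_bound[of "f + g" f] f g by (simp add: norm_mult)
  then have "2 * nrm V f \<le> nrm V (f + g)" if "f \<noteq> 0"
    using nrm_pos[OF f that] by (simp add: mult.assoc[symmetric])
  then have "2 * nrm V f \<le> nrm V (f + g)"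
    using f g by (cases "f = 0") simp_all
  then show "f = g"
    using eq_of_nrm_midpoint[OF f g nrm] by simp
qed

end


section \<open>Bounded maps and the dual space\<close>

text \<open>The infimum is itself admissible: each \<open>u \<noteq> 0\<close> bounds all admissible
  constants below by \<open>nrm W (T u) / nrm V u\<close>. As \<open>T\<close> need not be linear,
  \<open>u = 0\<close> is settled by an admissible constant.\<close>

lemma (in complex_normed)
  assumes "T \<in> bounded_maps V W"
  shows bounded_maps_norm_nonneg: "0 \<le> bounded_maps_norm V W T"
    and bounded_maps_norm_bound: "u \<in> carrier V \<Longrightarrow> nrm W (T u) \<le> bounded_maps_norm V W T * nrm V u"
proof -
  obtain \<alpha> where \<alpha>: "0 \<le> \<alpha>" "\<And>u. u \<in> carrier V \<Longrightarrow> nrm W (T u) \<le> \<alpha> * nrm V u"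
    using assms by (auto simp: bounded_maps_def)
  then have ne: "{\<alpha>. 0 \<le> \<alpha> \<and> (\<forall>u\<in>carrier V. nrm W (T u) \<le> \<alpha> * nrm V u)} \<noteq> {}"
    by blast
  show "0 \<le> bounded_maps_norm V W T"
    unfolding bounded_maps_norm_def by (rule cInf_greatest[OF ne]) simp
  assume u: "u \<in> carrier V"
  show "nrm W (T u) \<le> bounded_maps_norm V W T * nrm V u"
  proof (cases "u = 0")
    case True
    then show ?thesis
      using \<alpha>(2)[OF u] by simp
  next
    case False
    have "nrm W (T u) / nrm V u \<le> bounded_maps_norm V W T"
      unfolding bounded_maps_norm_def
      by (rule cInf_greatest[OF ne]) (use u nrm_pos[OF u False] in \<open>simp add: divide_le_eq\<close>)
    then show ?thesis
      using nrm_pos[OF u False] by (simp add: divide_le_eq)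
  qed
qed

lemma bounded_maps_norm_le:
  assumes "0 \<le> \<alpha>" "\<And>u. u \<in> carrier V \<Longrightarrow> nrm W (T u) \<le> \<alpha> * nrm V u"
  shows "bounded_maps_norm V W T \<le> \<alpha>"
  unfolding bounded_maps_norm_def
  by (rule cInf_lower) (use assms in \<open>auto intro: bdd_belowI[of _ 0]\<close>)

lemma mem_bounded_ops:
  "T \<in> carrier (bounded_ops V W) \<longleftrightarrow>
    (\<forall>u. if u \<in> carrier V then T u \<in> carrier W else T u = 0) \<and>
    (\<exists>\<alpha>\<ge>0. \<forall>u\<in>carrier V. nrm W (T u) \<le> \<alpha> * nrm V u) \<and>
    (\<forall>u\<in>carrier V. \<forall>v\<in>carrier V. T (u + v) = T u + T v) \<and>
    (\<forall>a. \<forall>u\<in>carrier V. T (a *\<^sub>C u) = a *\<^sub>C T u)"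
  by (auto simp: bounded_ops_def bounded_maps_def funcset0_def)

locale normed_pair = V: complex_normed V + W: complex_normed W
  for V :: "'v::complex_vector nspace" and W :: "'w::complex_vector nspace"
begin

section \<open>The operator norm\<close>

lemma unit_ball_ne: "{nrm W (T u) | u. u \<in> carrier V \<and> nrm V u \<le> 1} \<noteq> {}"
  by (auto intro!: exI[of _ 0])

lemma bounded_ops_upper:
  assumes T: "T \<in> carrier (bounded_ops V W)" and u: "u \<in> carrier V" "nrm V u \<le> 1"
  shows "nrm W (T u) \<le> nrm (bounded_ops V W) T"
proof -
  obtain \<alpha> where \<alpha>: "0 \<le> \<alpha>" "\<And>u. u \<in> carrier V \<Longrightarrow> nrm W (T u) \<le> \<alpha> * nrm V u"
    using T by (auto simp: mem_bounded_ops)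
  have "nrm W (T v) \<le> \<alpha>" if "v \<in> carrier V" "nrm V v \<le> 1" for v
    using \<alpha>(2)[OF that(1)] mult_left_mono[OF that(2) \<alpha>(1)] by simp
  then show ?thesis
    using u by (auto simp: bounded_ops_def intro!: cSup_upper bdd_aboveI[of _ \<alpha>])
qed

lemma bounded_ops_bound:
  assumes T: "T \<in> carrier (bounded_ops V W)" and u: "u \<in> carrier V"
  shows "nrm W (T u) \<le> nrm (bounded_ops V W) T * nrm V u"
proof (cases "u = 0")
  case True
  have "T (0 *\<^sub>C 0) = 0 *\<^sub>C T 0"
    using T V.zero_mem unfolding mem_bounded_ops by blast
  then show ?thesis
    using True by simp
next
  case False
  define c where "c = complex_of_real (1 / nrm V u)"
  have "nrm W (T (c *\<^sub>C u)) \<le> nrm (bounded_ops V W) T"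
    using bounded_ops_upper[OF T, of "c *\<^sub>C u"] V.nrm_normalize[OF u False] u by (simp add: c_def)
  moreover have "nrm W (T (c *\<^sub>C u)) = nrm W (T u) / nrm V u"
    using T u V.nrm_pos[OF u False] by (auto simp: mem_bounded_ops c_def norm_divide)
  ultimately show ?thesis
    using V.nrm_pos[OF u False] by (simp add: divide_le_eq)
qed

lemma bounded_ops_least:
  assumes "\<And>u. u \<in> carrier V \<Longrightarrow> nrm V u \<le> 1 \<Longrightarrow> nrm W (T u) \<le> \<alpha>"
  shows "nrm (bounded_ops V W) T \<le> \<alpha>"
  unfolding bounded_ops_def nspace.simps
  by (rule cSup_least[OF unit_ball_ne]) (use assms in auto)

text \<open>With the scalar field as target this makes the dual a normed space, on whose metric the
  density claim rests.\<close>

lemma normed_space_bounded_ops: "normed_space (bounded_ops V W)"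
proof -
  let ?B = "bounded_ops V W"
  have bnd: "\<And>T u. T \<in> carrier ?B \<Longrightarrow> u \<in> carrier V \<Longrightarrow> nrm W (T u) \<le> nrm ?B T * nrm V u"
    by (rule bounded_ops_bound)
  have memW: "\<And>T u. T \<in> carrier ?B \<Longrightarrow> u \<in> carrier V \<Longrightarrow> T u \<in> carrier W"
    by (simp add: mem_bounded_ops)
  have nonneg: "0 \<le> nrm ?B T" if "T \<in> carrier ?B" for T
    using bounded_ops_upper[OF that V.zero_mem] W.nrm_nonneg[OF memW[OF that V.zero_mem]] by simp
  have zero: "0 \<in> carrier ?B"
    by (auto simp: mem_bounded_ops intro: exI[of _ 0])
  have add: "S + T \<in> carrier ?B" if S: "S \<in> carrier ?B" and T: "T \<in> carrier ?B" for S T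
  proof -
    have "nrm W ((S + T) u) \<le> (nrm ?B S + nrm ?B T) * nrm V u" if "u \<in> carrier V" for u
      using W.nrm_triangle[OF memW[OF S that] memW[OF T that]] bnd[OF S that] bnd[OF T that]
      by (simp add: distrib_right)
    then have "\<exists>\<alpha>\<ge>0. \<forall>u\<in>carrier V. nrm W ((S + T) u) \<le> \<alpha> * nrm V u"
      using nonneg[OF S] nonneg[OF T] by (intro exI[of _ "nrm ?B S + nrm ?B T"]) simp
    then show ?thesis
      using S T by (simp add: mem_bounded_ops scaleC_add_right)
  qed
  have scale: "a *\<^sub>C T \<in> carrier ?B" if T: "T \<in> carrier ?B" for a T
  proof -
    have "nrm W ((a *\<^sub>C T) u) \<le> (cmod a * nrm ?B T) * nrm V u" if "u \<in> carrier V" for u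
      using mult_left_mono[OF bnd[OF T that], of "cmod a"] memW[OF T that]
      by (simp add: scaleC_fun_def mult.assoc)
    then have "\<exists>\<alpha>\<ge>0. \<forall>u\<in>carrier V. nrm W ((a *\<^sub>C T) u) \<le> \<alpha> * nrm V u"
      using nonneg[OF T] by (intro exI[of _ "cmod a * nrm ?B T"]) simp
    then show ?thesis
      using T by (simp add: mem_bounded_ops scaleC_fun_def scaleC_add_right mult.commute)
  qed
  have nrm_zero: "nrm ?B T = 0 \<longleftrightarrow> T = 0" if T: "T \<in> carrier ?B" for T
  proof
    assume "nrm ?B T = 0"
    then have "T u = 0" if "u \<in> carrier V" for u
      using bnd[OF T that] W.nrm_eq_0[OF memW[OF T that]] W.nrm_nonneg[OF memW[OF T that]] by simp
    then show "T = 0"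
      using T unfolding mem_bounded_ops fun_eq_iff by (metis zero_fun_apply)
  next
    assume "T = 0"
    then show "nrm ?B T = 0"
      using nonneg[OF T] bounded_ops_least[of T 0] by simp
  qed
  have nrm_scale_le: "nrm ?B (a *\<^sub>C T) \<le> cmod a * nrm ?B T" if T: "T \<in> carrier ?B" for a T
    using bounded_ops_upper[OF T] memW[OF T]
    by (intro bounded_ops_least) (simp add: scaleC_fun_def mult_left_mono)
  have nrm_scale: "nrm ?B (a *\<^sub>C T) = cmod a * nrm ?B T" if T: "T \<in> carrier ?B" for a T
  proof (cases "a = 0")
    case True
    then show ?thesis
      using nrm_zero[OF zero] by simp
  next
    case False
    \<comment> \<open>The one-sided estimate, applied to \<open>inverse a\<close> and
      \<open>a *\<^sub>C T\<close>, gives the reverse inequality.\<close>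
    have "nrm ?B (inverse a *\<^sub>C a *\<^sub>C T) \<le> cmod (inverse a) * nrm ?B (a *\<^sub>C T)"
      by (rule nrm_scale_le[OF scale[OF T]])
    then have "cmod a * nrm ?B T \<le> cmod a * (cmod (inverse a) * nrm ?B (a *\<^sub>C T))"
      using False by (intro mult_left_mono) (simp_all add: scaleC_one)
    also have "\<dots> = nrm ?B (a *\<^sub>C T)"
      using False by (simp flip: mult.assoc norm_mult)
    finally have "cmod a * nrm ?B T \<le> nrm ?B (a *\<^sub>C T)" .
    then show ?thesis
      using nrm_scale_le[OF T, of a] by simp
  qed
  have nrm_add: "nrm ?B (S + T) \<le> nrm ?B S + nrm ?B T"
    if S: "S \<in> carrier ?B" and T: "T \<in> carrier ?B" for S T
  proof (rule bounded_ops_least)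
    fix u
    assume u: "u \<in> carrier V" "nrm V u \<le> 1"
    then show "nrm W ((S + T) u) \<le> nrm ?B S + nrm ?B T"
      using W.nrm_triangle[OF memW[OF S] memW[OF T]] bounded_ops_upper[OF S u] bounded_ops_upper[OF T u]
      by fastforce
  qed
  show ?thesis
    unfolding normed_space_def complex_vector.subspace_def
    by (intro conjI ballI allI nonneg zero add scale nrm_zero nrm_scale nrm_add)
qed

end

lemma complex_normed_complex: "complex_normed complex_nspace"
  by unfold_locales
    (auto simp: normed_space_def complex_nspace_def complex_vector.subspace_def scaleC_complex_def
      norm_mult norm_triangle_ineq)

context complex_normed
begin

section \<open>Functionals and almost norming vectors\<close>

lemma normed_pair_dual: "normed_pair V complex_nspace"
  by (simp add: normed_pair_def complex_normed_axioms complex_normed_complex)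

lemma normed_space_dual: "normed_space (dual V)"
  unfolding dual_def by (rule normed_pair.normed_space_bounded_ops[OF normed_pair_dual])

lemma complex_normed_dual: "complex_normed (dual V)"
  by (rule complex_normed.intro) (rule normed_space_dual)

lemma mem_dual:
  "\<phi> \<in> carrier (dual V) \<longleftrightarrow>
    (\<forall>u. u \<notin> carrier V \<longrightarrow> \<phi> u = 0) \<and>
    (\<exists>\<alpha>\<ge>0. \<forall>u\<in>carrier V. cmod (\<phi> u) \<le> \<alpha> * nrm V u) \<and>
    (\<forall>u\<in>carrier V. \<forall>v\<in>carrier V. \<phi> (u + v) = \<phi> u + \<phi> v) \<and>
    (\<forall>a. \<forall>u\<in>carrier V. \<phi> (a *\<^sub>C u) = a * \<phi> u)"
  by (simp add: dual_def mem_bounded_ops complex_nspace_def scaleC_complex_def)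

lemma dual_bound: "\<phi> \<in> carrier (dual V) \<Longrightarrow> u \<in> carrier V \<Longrightarrow> cmod (\<phi> u) \<le> nrm (dual V) \<phi> * nrm V u"
  using normed_pair.bounded_ops_bound[OF normed_pair_dual, of \<phi> u]
  by (simp add: dual_def complex_nspace_def)

lemma Re_dual_bound:
  assumes "\<phi> \<in> carrier (dual V)" "u \<in> carrier V"
  shows "Re (\<phi> u) \<le> nrm (dual V) \<phi> * nrm V u"
  using dual_bound[OF assms] complex_Re_le_cmod[of "\<phi> u"] by linarith

lemma almost_norming:
  assumes \<phi>: "\<phi> \<in> carrier (dual V)" and pos: "0 < nrm (dual V) \<phi>" and c: "c < nrm (dual V) \<phi>"
  obtains f where "f \<in> unit_sphere V" "c < Re (\<phi> f)"
proof -
  \<comment> \<open>Also for negative \<open>c\<close>, the vector found must satisfy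
    \<open>\<phi> u \<noteq> 0\<close> in order to be normalized and rotated.\<close>
  define c' where "c' = max c 0"
  have "\<not> nrm (dual V) \<phi> \<le> c'"
    using pos c by (simp add: c'_def)
  then obtain u where u: "u \<in> carrier V" "nrm V u \<le> 1" "c' < cmod (\<phi> u)"
    using normed_pair.bounded_ops_least[OF normed_pair_dual, of \<phi> c']
    unfolding dual_def by (force simp: complex_nspace_def not_le)
  have lin: "\<phi> (a *\<^sub>C u) = a * \<phi> u" for a
    using \<phi> u(1) by (simp add: mem_dual)
  have "\<phi> u \<noteq> 0"
    using u(3) by (auto simp: c'_def)
  then have "u \<noteq> 0"
    using lin[of 0] by auto
  then have pos_u: "0 < nrm V u"
    using u(1) by (simp add: nrm_pos)
  \<comment> \<open>Rotates \<open>\<phi> u\<close> onto the positive axis and normalizes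
    \<open>u\<close>; as \<open>nrm V u \<le> 1\<close>, the value does not decrease.\<close>
  define a where "a = complex_of_real (cmod (\<phi> u)) / (\<phi> u * complex_of_real (nrm V u))"
  have "cmod a = 1 / nrm V u"
    using \<open>\<phi> u \<noteq> 0\<close> pos_u by (simp add: a_def norm_divide norm_mult)
  then have "a *\<^sub>C u \<in> unit_sphere V"
    using u(1) \<open>u \<noteq> 0\<close> by (simp add: unit_sphere_def)
  moreover have "\<phi> (a *\<^sub>C u) = complex_of_real (cmod (\<phi> u) / nrm V u)"
    using \<open>\<phi> u \<noteq> 0\<close> by (simp add: lin a_def)
  then have "Re (\<phi> (a *\<^sub>C u)) = cmod (\<phi> u) / nrm V u"
    by simp
  moreover have "cmod (\<phi> u) \<le> cmod (\<phi> u) / nrm V u"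
    using u(2) pos_u by (simp add: le_divide_eq mult_left_le)
  then have "c < cmod (\<phi> u) / nrm V u"
    using u(3) by (simp add: c'_def)
  ultimately show ?thesis
    using that by metis
qed

end


section \<open>A density criterion\<close>

context uniform_normed
begin

lemma duality_map_mem:
  assumes f: "f \<in> carrier V"
  shows "duality_map V f \<in> carrier (dual V)"
proof -
  have "\<exists>\<alpha>\<ge>0. \<forall>u\<in>carrier V. cmod (duality_map V f u) \<le> \<alpha> * nrm V u"
    using f by (intro exI[of _ "nrm V f"]) (simp add: sip_bound mult.commute)
  moreover have "duality_map V f u = 0" if "u \<notin> carrier V" for u
    using that by (simp add: duality_map_def restrict0_def)
  ultimately show ?thesis
    using f by (simp add: mem_dual sip_add sip_scale)
qed

text \<open>Two almost norming vectors of one functional have a sum of norm near 2, so uniform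
  convexity brings them together. The point is that \<delta> depends on \<open>d\<close> and
  \<epsilon> but not on \<phi>.\<close>

lemma almost_norming_close:
  assumes "0 < d" "0 < \<epsilon>"
  obtains \<delta> where "0 < \<delta>"
    "\<And>\<phi> f g. \<phi> \<in> carrier (dual V) \<Longrightarrow> nrm (dual V) \<phi> \<le> d + \<delta> \<Longrightarrow> f \<in> unit_sphere V \<Longrightarrow>
      g \<in> unit_sphere V \<Longrightarrow> d - \<delta> \<le> Re (\<phi> f) \<Longrightarrow> d - \<delta> \<le> Re (\<phi> g) \<Longrightarrow> nrm V (f - g) < \<epsilon>"
proof -
  obtain \<delta> where "0 < \<delta>" and \<delta>: "\<And>f g. f \<in> carrier V \<Longrightarrow> g \<in> carrier V \<Longrightarrow> nrm V f = 1 \<Longrightarrow>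
      nrm V g = 1 \<Longrightarrow> \<epsilon> \<le> nrm V (f - g) \<Longrightarrow> nrm V (f + g) \<le> 2 - \<delta>"
    using uniform assms(2) unfolding uniform_banach_space_def uniformly_convex_def by blast
  \<comment> \<open>Comparing \<open>2 * (d - \<delta>')\<close> with
    \<open>(d + \<delta>') * (2 - \<delta>)\<close> leaves \<open>d * \<delta>\<close> below
    \<open>4 * \<delta>'\<close>; the 8 contradicts this.\<close>
  define \<delta>' where "\<delta>' = d * \<delta> / 8"
  have "0 < \<delta>'"
    using assms(1) \<open>0 < \<delta>\<close> by (simp add: \<delta>'_def)
  show ?thesis
  proof (rule that[OF \<open>0 < \<delta>'\<close>], rule ccontr)
    fix \<phi> f g
    assume \<phi>: "\<phi> \<in> carrier (dual V)" "nrm (dual V) \<phi> \<le> d + \<delta>'"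
      and fg: "f \<in> unit_sphere V" "g \<in> unit_sphere V"
      and Re: "d - \<delta>' \<le> Re (\<phi> f)" "d - \<delta>' \<le> Re (\<phi> g)" and "\<not> nrm V (f - g) < \<epsilon>"
    then have mem: "f \<in> carrier V" "g \<in> carrier V" and le: "nrm V (f + g) \<le> 2 - \<delta>"
      using \<delta>[of f g] by (simp_all add: unit_sphere_def)
    have "2 * (d - \<delta>') \<le> Re (\<phi> (f + g))"
      using Re \<phi>(1) mem by (simp add: mem_dual)
    also have "\<dots> \<le> nrm (dual V) \<phi> * nrm V (f + g)"
      using mem by (intro Re_dual_bound \<phi>) simp
    also have "\<dots> \<le> (d + \<delta>') * (2 - \<delta>)"
      using \<phi>(2) le mem assms(1) \<open>0 < \<delta>'\<close> by (intro mult_mono) simp_all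
    finally have "d * \<delta> + \<delta>' * \<delta> \<le> 4 * \<delta>'"
      by (simp add: algebra_simps)
    moreover have "0 < \<delta>' * \<delta>" "d * \<delta> = 8 * \<delta>'"
      using \<open>0 < \<delta>\<close> \<open>0 < \<delta>'\<close> by (simp_all add: \<delta>'_def)
    ultimately show False
      using \<open>0 < \<delta>'\<close> by linarith
  qed
qed

text \<open>
  This replaces Hahn--Banach and reflexivity: uniform convexity forces almost norming vectors of
  almost shortest elements of the coset \<open>\<psi> + M\<close> to converge, and the first-order
  condition at the limit says that the limit is annihilated by \<open>M\<close>.
\<close>

lemma common_zero_of_far_subspace:
  assumes M: "complex_vector.subspace M" "M \<subseteq> carrier (dual V)"
    and \<psi>: "\<psi> \<in> carrier (dual V)"
    and d: "0 < d" "\<And>m. m \<in> M \<Longrightarrow> d \<le> nrm (dual V) (\<psi> - m)"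
  obtains f where "f \<in> carrier V" "f \<noteq> 0" "\<And>m. m \<in> M \<Longrightarrow> m f = 0"
proof -
  interpret dual: complex_normed "dual V"
    by (rule complex_normed_dual)
  let ?N = "nrm (dual V)"
  define A where "A = {\<psi> - m | m. m \<in> M}"
  define D where "D = Inf (?N ` A)"
  have A_dual: "\<phi> \<in> carrier (dual V)" if "\<phi> \<in> A" for \<phi>
    using that M(2) \<psi> by (auto simp: A_def)
  have A_ne: "?N ` A \<noteq> {}"
    using complex_vector.subspace_0[OF M(1)] by (auto simp: A_def)
  have A_ge_d: "d \<le> ?N \<phi>" if "\<phi> \<in> A" for \<phi>
    using that d(2) by (auto simp: A_def)
  then have "d \<le> D"
    unfolding D_def using A_ne by (intro cInf_greatest) auto
  with d(1) have "0 < D"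
    by simp
  have D_le: "D \<le> ?N \<phi>" if "\<phi> \<in> A" for \<phi>
    unfolding D_def using that A_ge_d by (intro cInf_lower) (auto intro: bdd_belowI[of _ d])
  have norming: "\<exists>g\<in>unit_sphere V. c < Re (\<phi> g)" if \<phi>: "\<phi> \<in> A" and "c < D" for \<phi> c
  proof -
    have "0 < ?N \<phi>" "c < ?N \<phi>"
      using D_le[OF \<phi>] \<open>0 < D\<close> \<open>c < D\<close> by simp_all
    with A_dual[OF \<phi>] show ?thesis
      by (rule almost_norming) blast
  qed
  have almost_min: "\<exists>\<phi>\<in>A. ?N \<phi> < D + \<delta>" if "0 < \<delta>" for \<delta>
    using cInf_lessD[OF A_ne, of "D + \<delta>"] that by (auto simp: D_def)
  have shift: "\<phi> - m \<in> A" if \<phi>: "\<phi> \<in> A" and m: "m \<in> M" for \<phi> m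
  proof -
    obtain m' where m': "m' \<in> M" "\<phi> = \<psi> - m'"
      using \<phi> unfolding A_def by blast
    then have "\<phi> - m = \<psi> - (m' + m)" "m' + m \<in> M"
      using complex_vector.subspace_add[OF M(1) m'(1) m] by (simp_all only: diff_diff_eq)
    then show ?thesis
      unfolding A_def by blast
  qed
  \<comment> \<open>Convexity of the coset links different functionals: the average of two almost
    shortest ones still has norm at least \<open>D\<close>, so a vector almost norming the average
    almost norms both.\<close>
  have midpoint: "(1 / 2) *\<^sub>C (\<phi> + \<phi>') \<in> A" if \<phi>: "\<phi> \<in> A" "\<phi>' \<in> A" for \<phi> \<phi>'
  proof -
    obtain m m' where m: "m \<in> M" "m' \<in> M" "\<phi> = \<psi> - m" "\<phi>' = \<psi> - m'"
      using \<phi> unfolding A_def by blast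
    have "(1 / 2) *\<^sub>C (\<phi> + \<phi>') = \<psi> - (1 / 2) *\<^sub>C (m + m')"
      unfolding m(3,4) by (rule ext) (simp add: scaleC_fun_def scaleC_complex_def field_simps)
    then show ?thesis
      using m complex_vector.subspace_add[OF M(1)] complex_vector.subspace_scale[OF M(1)]
      unfolding A_def by blast
  qed
  have close: "\<exists>\<delta>>0. \<forall>\<phi>\<in>A. \<forall>\<phi>'\<in>A. \<forall>f\<in>unit_sphere V. \<forall>f'\<in>unit_sphere V.
      ?N \<phi> \<le> D + \<delta> \<longrightarrow> ?N \<phi>' \<le> D + \<delta> \<longrightarrow> D - \<delta> \<le> Re (\<phi> f) \<longrightarrow> D - \<delta> \<le> Re (\<phi>' f') \<longrightarrow>
      nrm V (f - f') < \<epsilon>" if "0 < \<epsilon>" for \<epsilon>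
  proof -
    obtain \<delta> where "0 < \<delta>"
      and \<delta>: "\<And>\<phi> f g. \<phi> \<in> carrier (dual V) \<Longrightarrow> ?N \<phi> \<le> D + \<delta> \<Longrightarrow> f \<in> unit_sphere V \<Longrightarrow>
        g \<in> unit_sphere V \<Longrightarrow> D - \<delta> \<le> Re (\<phi> f) \<Longrightarrow> D - \<delta> \<le> Re (\<phi> g) \<Longrightarrow> nrm V (f - g) < \<epsilon> / 2"
      using almost_norming_close[OF \<open>0 < D\<close>, of "\<epsilon> / 2"] \<open>0 < \<epsilon>\<close> by auto
    have "nrm V (f - f') < \<epsilon>"
      if \<phi>: "\<phi> \<in> A" "\<phi>' \<in> A" "?N \<phi> \<le> D + \<delta> / 3" "?N \<phi>' \<le> D + \<delta> / 3"
        and f: "f \<in> unit_sphere V" "f' \<in> unit_sphere V"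
        and Re: "D - \<delta> / 3 \<le> Re (\<phi> f)" "D - \<delta> / 3 \<le> Re (\<phi>' f')" for \<phi> \<phi>' f f'
    proof -
      \<comment> \<open>The average exceeds \<open>D - \<delta> / 3\<close> at \<open>g\<close> and
        each functional is at most \<open>D + \<delta> / 3\<close> there, so the other is at least
        \<open>D - \<delta>\<close>; hence the thirds. This \<open>g\<close> is then compared with
        \<open>f\<close> and with \<open>f'\<close>.\<close>
      obtain g where g: "g \<in> unit_sphere V" "D - \<delta> / 3 < Re (((1 / 2) *\<^sub>C (\<phi> + \<phi>')) g)"
        using norming[OF midpoint[OF \<phi>(1,2)], of "D - \<delta> / 3"] \<open>0 < \<delta>\<close> by auto
      have "Re (((1 / 2) *\<^sub>C (\<phi> + \<phi>')) g) = (Re (\<phi> g) + Re (\<phi>' g)) / 2"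
        by (simp add: scaleC_fun_def scaleC_complex_def)
      moreover have "Re (\<phi> g) \<le> D + \<delta> / 3" "Re (\<phi>' g) \<le> D + \<delta> / 3"
        using Re_dual_bound[OF A_dual, of \<phi> g] Re_dual_bound[OF A_dual, of \<phi>' g] \<phi> g(1)
        by (simp_all add: unit_sphere_def)
      ultimately have "D - \<delta> \<le> Re (\<phi> g)" "D - \<delta> \<le> Re (\<phi>' g)"
        using g(2) by (simp_all add: field_simps)
      note Re_g = this
      have "nrm V (f - g) < \<epsilon> / 2"
        by (rule \<delta>[OF A_dual[OF \<phi>(1)]]) (use Re Re_g \<phi> f g(1) \<open>0 < \<delta>\<close> in simp_all)
      moreover have "nrm V (f' - g) < \<epsilon> / 2"
        by (rule \<delta>[OF A_dual[OF \<phi>(2)]]) (use Re Re_g \<phi> f g(1) \<open>0 < \<delta>\<close> in simp_all)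
      ultimately show ?thesis
        using nrm_triangle[of "f - g" "g - f'"] nrm_diff_commute[of f' g] f g(1)
        by (simp add: unit_sphere_def)
    qed
    then show ?thesis
      using \<open>0 < \<delta>\<close> by (intro exI[of _ "\<delta> / 3"] conjI ballI impI) simp_all
  qed

  \<comment> \<open>Tolerances for a minimizing sequence in the coset and its almost norming
    vectors, whose limit \<open>F\<close> is the desired zero.\<close>
  define \<rho> where "\<rho> n = inverse (real (Suc n))" for n
  have \<rho>_pos: "0 < \<rho> n" for n
    by (simp add: \<rho>_def)
  have \<rho>_small: "\<exists>N. \<forall>n\<ge>N. \<rho> n < e" if "0 < e" for e
    using LIMSEQ_inverse_real_of_nat that unfolding \<rho>_def LIMSEQ_iff by fastforce
  obtain \<phi> where \<phi>: "\<And>n. \<phi> n \<in> A" "\<And>n. ?N (\<phi> n) < D + \<rho> n"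
    using almost_min[OF \<rho>_pos] by metis
  have "\<exists>f\<in>unit_sphere V. D - \<rho> n < Re (\<phi> n f)" for n
    using norming[OF \<phi>(1), of "D - \<rho> n" n] \<rho>_pos[of n] by simp
  then obtain f where f: "\<And>n. f n \<in> unit_sphere V" "\<And>n. D - \<rho> n < Re (\<phi> n (f n))"
    by metis
  have f_mem: "f n \<in> carrier V" and f_nrm: "nrm V (f n) = 1" for n
    using f(1)[of n] by (simp_all add: unit_sphere_def)

  interpret metric: Metric_space "carrier V" "nspace_dist V"
    by (rule Metric_space_nspace[OF normed])
  have "metric.MCauchy f"
    unfolding metric.MCauchy_def
  proof (intro conjI allI impI)
    fix \<epsilon> :: real
    assume "0 < \<epsilon>"
    from close[OF this] obtain \<delta> where "0 < \<delta>"
      and \<delta>: "\<forall>\<phi>\<in>A. \<forall>\<phi>'\<in>A. \<forall>f\<in>unit_sphere V. \<forall>f'\<in>unit_sphere V. ?N \<phi> \<le> D + \<delta> \<longrightarrow>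
        ?N \<phi>' \<le> D + \<delta> \<longrightarrow> D - \<delta> \<le> Re (\<phi> f) \<longrightarrow> D - \<delta> \<le> Re (\<phi>' f') \<longrightarrow> nrm V (f - f') < \<epsilon>"
      by auto
    obtain N where N: "\<And>n. N \<le> n \<Longrightarrow> \<rho> n < \<delta>"
      using \<rho>_small[OF \<open>0 < \<delta>\<close>] by blast
    have bnd: "?N (\<phi> n) \<le> D + \<delta>" "D - \<delta> \<le> Re (\<phi> n (f n))" if "N \<le> n" for n
      using N[OF that] \<phi>(2)[of n] f(2)[of n] by simp_all
    have "nspace_dist V (f n) (f n') < \<epsilon>" if "N \<le> n" "N \<le> n'" for n n'
      using \<delta>[rule_format, OF \<phi>(1) \<phi>(1) f(1) f(1) bnd(1) bnd(1) bnd(2) bnd(2)] that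
      by (simp add: nspace_dist_def f_mem)
    then show "\<exists>N. \<forall>n n'. N \<le> n \<longrightarrow> N \<le> n' \<longrightarrow> nspace_dist V (f n) (f n') < \<epsilon>"
      by blast
  qed (use f_mem in auto)
  then obtain F where F: "F \<in> carrier V"
    and lim: "\<And>\<epsilon>. 0 < \<epsilon> \<Longrightarrow> \<exists>N. \<forall>n\<ge>N. nspace_dist V (f n) F < \<epsilon>"
    using uniform unfolding uniform_banach_space_def banach_space_def metric.mcomplete_def
      metric.limit_metric_sequentially by metis
  have F_lim: "\<exists>N. \<forall>n\<ge>N. nrm V (f n - F) < \<epsilon>" if "0 < \<epsilon>" for \<epsilon>
    using lim[OF that] F f_mem by (simp add: nspace_dist_def)

  \<comment> \<open>First-order condition: moving from an almost shortest functional along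
    \<open>- t m\<close> cannot bring the norm below \<open>D\<close>, so at a vector almost norming
    the moved functional, which is close to \<open>F\<close>, the real part of \<open>m\<close> is
    almost nonpositive.\<close>
  have Re_le: "Re (m F) \<le> 0" if m: "m \<in> M" for m
  proof -
    have m_dual: "m \<in> carrier (dual V)"
      using m M(2) by auto
    have m_diff: "m (u - v) = m u - m v" if "u \<in> carrier V" "v \<in> carrier V" for u v
    proof -
      have "m (u - v + v) = m (u - v) + m v"
        using m_dual that diff_mem unfolding mem_dual by blast
      then show ?thesis by simp
    qed
    define C where "C = ?N m + 1"
    have C: "0 < C" "?N m \<le> C"
      using dual.nrm_nonneg[OF m_dual] by (simp_all add: C_def)
    \<comment> \<open>The share \<open>2 * \<epsilon>\<close> bounds \<open>Re (m g)\<close> at the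
      norming vector \<open>g\<close> of the moved functional; \<open>2 * C * \<epsilon>\<close>
      pays for replacing \<open>g\<close> by \<open>F\<close>.\<close>
    have le: "Re (m F) \<le> (2 + 2 * C) * \<epsilon>" if "0 < \<epsilon>" for \<epsilon>
    proof -
      obtain \<delta> where "0 < \<delta>"
        and \<delta>: "\<forall>\<phi>\<in>A. \<forall>\<phi>'\<in>A. \<forall>f\<in>unit_sphere V. \<forall>f'\<in>unit_sphere V. ?N \<phi> \<le> D + \<delta> \<longrightarrow>
          ?N \<phi>' \<le> D + \<delta> \<longrightarrow> D - \<delta> \<le> Re (\<phi> f) \<longrightarrow> D - \<delta> \<le> Re (\<phi>' f') \<longrightarrow> nrm V (f - f') < \<epsilon>"
        using close[OF \<open>0 < \<epsilon>\<close>] by auto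
      \<comment> \<open>This \<open>t\<close> makes the move cost at most
        \<open>\<delta> / 2\<close> in norm. In \<eta>, the bound \<open>\<delta> / 2\<close> leaves
        the other half to \<open>\<phi> n\<close>, and \<open>t * \<epsilon>\<close> keeps the error
        \<open>2 * \<eta>\<close> small after division by \<open>t\<close>.\<close>
      define t where "t = \<delta> / (2 * C)"
      define \<eta> where "\<eta> = min (\<delta> / 2) (t * \<epsilon>)"
      have t: "0 < t" "t * C = \<delta> / 2"
        using C \<open>0 < \<delta>\<close> by (simp_all add: t_def)
      have \<eta>: "0 < \<eta>" "\<eta> \<le> \<delta> / 2" "\<eta> \<le> t * \<epsilon>"
        using \<open>0 < \<delta>\<close> \<open>0 < \<epsilon>\<close> t by (simp_all add: \<eta>_def)
      obtain N1 N2 where "\<forall>n\<ge>N1. \<rho> n < \<eta>" "\<forall>n\<ge>N2. nrm V (f n - F) < \<epsilon>"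
        using \<rho>_small[OF \<eta>(1)] F_lim[OF \<open>0 < \<epsilon>\<close>] by blast
      then obtain n where n: "\<rho> n < \<eta>" "nrm V (f n - F) < \<epsilon>"
        using max.cobounded1[of N1 N2] max.cobounded2[of N2 N1] by blast
      define \<phi>' where "\<phi>' = \<phi> n - complex_of_real t *\<^sub>C m"
      have tm: "complex_of_real t *\<^sub>C m \<in> M"
        by (rule complex_vector.subspace_scale[OF M(1) m])
      have \<phi>'_A: "\<phi>' \<in> A"
        unfolding \<phi>'_def by (rule shift[OF \<phi>(1) tm])
      have "?N (complex_of_real t *\<^sub>C m) \<le> \<delta> / 2"
        using mult_left_mono[OF C(2), of t] t m_dual by simp
      moreover have "?N \<phi>' \<le> ?N (\<phi> n) + ?N (complex_of_real t *\<^sub>C m)"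
        using dual.nrm_triangle_diff[of \<phi>' "\<phi> n"] A_dual[OF \<phi>'_A] A_dual[OF \<phi>(1)] m_dual
        by (simp add: \<phi>'_def)
      ultimately have \<phi>'_nrm: "?N \<phi>' \<le> D + \<delta>"
        using \<phi>(2)[of n] n(1) \<eta>(2) by simp
      obtain g where g: "g \<in> unit_sphere V" "D - \<eta> < Re (\<phi>' g)"
        using norming[OF \<phi>'_A, of "D - \<eta>"] \<eta>(1) by auto
      have g_mem: "g \<in> carrier V" "nrm V g = 1"
        using g(1) by (simp_all add: unit_sphere_def)
      have "nrm V (f n - g) < \<epsilon>"
        using \<phi>(2)[of n] f(2)[of n] n(1) \<eta>(1,2) g(2) \<open>0 < \<delta>\<close>
        by (intro \<delta>[rule_format, OF \<phi>(1)[of n] \<phi>'_A f(1) g(1) _ \<phi>'_nrm]) simp_all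
      moreover have "nrm V (F - g) \<le> nrm V (f n - F) + nrm V (f n - g)"
        using nrm_triangle[OF diff_mem[OF F f_mem[of n]] diff_mem[OF f_mem[of n] g_mem(1)]]
        unfolding nrm_diff_commute[OF F f_mem[of n]] by simp
      ultimately have "nrm V (F - g) \<le> 2 * \<epsilon>"
        using n(2) by linarith
      then have "Re (m (F - g)) \<le> C * (2 * \<epsilon>)"
        using Re_dual_bound[OF m_dual diff_mem[OF F g_mem(1)]] C nrm_nonneg[OF diff_mem[OF F g_mem(1)]]
          mult_mono[of "?N m" C "nrm V (F - g)" "2 * \<epsilon>"] by linarith
      moreover have "Re (m g) \<le> 2 * \<epsilon>"
      proof -
        have "t * Re (m g) = Re (\<phi> n g) - Re (\<phi>' g)"
          by (simp add: \<phi>'_def scaleC_fun_def scaleC_complex_def)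
        also have "\<dots> \<le> (D + \<eta>) - (D - \<eta>)"
          using Re_dual_bound[OF A_dual[OF \<phi>(1)] g_mem(1), of n] g_mem(2) \<phi>(2)[of n] n(1) g(2) by simp
        also have "\<dots> \<le> t * (2 * \<epsilon>)"
          using \<eta>(3) by simp
        finally show ?thesis
          using t(1) by simp
      qed
      ultimately show ?thesis
        using m_diff[OF F g_mem(1)] by (simp add: algebra_simps)
    qed
    show ?thesis
    proof (rule field_le_epsilon)
      fix e :: real
      assume "0 < e"
      then show "Re (m F) \<le> 0 + e"
        using le[of "e / (2 + 2 * C)"] C(1) by simp
    qed
  qed

  have "m F = 0" if m: "m \<in> M" for m
  proof -
    \<comment> \<open>Since \<open>M\<close> is a complex subspace, the phase of \<open>m F\<close>
      can be rotated away, which turns a bound on real parts into vanishing.\<close>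
    have "Re ((cnj (m F) *\<^sub>C m) F) \<le> 0"
      by (rule Re_le) (rule complex_vector.subspace_scale[OF M(1) m])
    moreover have "(cnj (m F) *\<^sub>C m) F = complex_of_real ((cmod (m F))\<^sup>2)"
      unfolding scaleC_fun_def scaleC_complex_def complex_norm_square by (rule mult.commute)
    ultimately show ?thesis
      by simp
  qed
  moreover have "F \<noteq> 0"
  proof
    assume "F = 0"
    then show False
      using F_lim[of 1] f_nrm by auto
  qed
  ultimately show ?thesis
    using that F by blast
qed

text \<open>A functional outside the closure has a ball around it that misses \<open>M\<close>; the
  radius serves as the distance \<open>d\<close> above.\<close>

lemma dual_dense_if_separating:
  assumes M: "complex_vector.subspace M" "M \<subseteq> carrier (dual V)"
    and sep: "\<And>f. f \<in> carrier V \<Longrightarrow> (\<And>m. m \<in> M \<Longrightarrow> m f = 0) \<Longrightarrow> f = 0"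
  shows "nspace_topology (dual V) closure_of M = carrier (dual V)"
proof -
  interpret dual: complex_normed "dual V"
    by (rule complex_normed_dual)
  interpret metric: Metric_space "carrier (dual V)" "nspace_dist (dual V)"
    by (rule Metric_space_nspace[OF dual.normed])
  have "\<exists>m\<in>M. nspace_dist (dual V) \<psi> m < e" if \<psi>: "\<psi> \<in> carrier (dual V)" and "0 < e" for \<psi> e
  proof (rule ccontr)
    assume "\<not> (\<exists>m\<in>M. nspace_dist (dual V) \<psi> m < e)"
    then have "e \<le> nrm (dual V) (\<psi> - m)" if "m \<in> M" for m
      using that subsetD[OF M(2) that] \<psi> by (auto simp: nspace_dist_def not_less)
    then obtain f where "f \<in> carrier V" "f \<noteq> 0" "\<And>m. m \<in> M \<Longrightarrow> m f = 0"
      using common_zero_of_far_subspace[OF M \<psi> \<open>0 < e\<close>] by blast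
    then show False
      using sep by blast
  qed
  then show ?thesis
    using M(2) unfolding nspace_topology_def metric.metric_closure_of
    by (auto simp: metric.mball_def subset_iff)
qed

end


section \<open>The reproducing kernel\<close>

locale kernel =
  fixes X :: "'x set"
    and \<Lambda> :: "'l::complex_vector nspace"
    and \<B> :: "('x \<Rightarrow> 'l) nspace"
    and K :: "'x \<Rightarrow> 'x \<Rightarrow> 'l \<Rightarrow> 'l"
  assumes rkbs: "rkbs X \<Lambda> \<B>"
    and kernel: "reproducing_kernel X \<Lambda> \<B> K"
begin

abbreviation k :: "'x \<Rightarrow> 'l \<Rightarrow> 'x \<Rightarrow> 'l"
  where "k \<equiv> kernel_section X K"

sublocale B: uniform_normed \<B>
  using rkbs by unfold_locales (auto simp: rkbs_def uniform_banach_space_def banach_space_def)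

sublocale L: uniform_normed \<Lambda>
  using rkbs by unfold_locales (auto simp: rkbs_def uniform_banach_space_def banach_space_def)

lemma eval_mem: "f \<in> carrier \<B> \<Longrightarrow> x \<in> X \<Longrightarrow> f x \<in> carrier \<Lambda>"
  using rkbs by (auto simp: rkbs_def banach_space_of_functions_def funcset0_def)

lemma eq_0_iff:
  assumes "f \<in> carrier \<B>"
  shows "f = 0 \<longleftrightarrow> (\<forall>x\<in>X. f x = 0)"
  using rkbs assms unfolding B.nrm_eq_0[OF assms, symmetric] rkbs_def banach_space_of_functions_def
  by blast

lemma K_bounded: "x \<in> X \<Longrightarrow> y \<in> X \<Longrightarrow> K x y \<in> bounded_maps \<Lambda> \<Lambda>"
  and k_mem: "x \<in> X \<Longrightarrow> \<xi> \<in> carrier \<Lambda> \<Longrightarrow> k x \<xi> \<in> carrier \<B>"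
  and reproducing: "x \<in> X \<Longrightarrow> \<xi> \<in> carrier \<Lambda> \<Longrightarrow> f \<in> carrier \<B> \<Longrightarrow> sip \<B> f (k x \<xi>) = sip \<Lambda> (f x) \<xi>"
  using kernel by (auto simp: reproducing_kernel_def)

section \<open>Cauchy-Schwarz bounds for the kernel\<close>

lemma k_apply: "y \<in> X \<Longrightarrow> k x \<xi> y = K x y \<xi>"
  by (simp add: kernel_section_def restrict0_def)

lemma K_mem: "x \<in> X \<Longrightarrow> y \<in> X \<Longrightarrow> \<xi> \<in> carrier \<Lambda> \<Longrightarrow> K x y \<xi> \<in> carrier \<Lambda>"
  using K_bounded by (auto simp: bounded_maps_def funcset0_def)

lemma sip_K: "x \<in> X \<Longrightarrow> y \<in> X \<Longrightarrow> \<xi> \<in> carrier \<Lambda> \<Longrightarrow> \<eta> \<in> carrier \<Lambda> \<Longrightarrow>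
    sip \<Lambda> (K x y \<xi>) \<eta> = sip \<B> (k x \<xi>) (k y \<eta>)"
  by (simp add: reproducing k_mem k_apply)

lemma sip_K_self: "x \<in> X \<Longrightarrow> \<xi> \<in> carrier \<Lambda> \<Longrightarrow>
    sip \<Lambda> (K x x \<xi>) \<xi> = complex_of_real ((nrm \<B> (k x \<xi>))\<^sup>2)"
  by (simp add: sip_K B.sip_self k_mem)

lemma cmod_sip_K_le:
  assumes "x \<in> X" "y \<in> X" "\<xi> \<in> carrier \<Lambda>" "\<eta> \<in> carrier \<Lambda>"
  shows "cmod (sip \<Lambda> (K x y \<xi>) \<eta>) \<le>
    sqrt (Re (sip \<Lambda> (K x x \<xi>) \<xi>)) * sqrt (Re (sip \<Lambda> (K y y \<eta>) \<eta>))"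
  using assms B.sip_bound[of "k x \<xi>" "k y \<eta>"] by (simp add: sip_K_self sip_K k_mem B.sip_self)

lemma nrm_k_le:
  assumes x: "x \<in> X" and \<xi>: "\<xi> \<in> carrier \<Lambda>"
  shows "nrm \<B> (k x \<xi>) \<le> sqrt (bounded_maps_norm \<Lambda> \<Lambda> (K x x)) * nrm \<Lambda> \<xi>"
proof (rule power2_le_imp_le)
  have "(nrm \<B> (k x \<xi>))\<^sup>2 \<le> nrm \<Lambda> (K x x \<xi>) * nrm \<Lambda> \<xi>"
    using L.sip_bound[OF K_mem[OF x x \<xi>] \<xi>] by (simp add: sip_K_self[OF x \<xi>] norm_power del: of_real_power)
  also have "\<dots> \<le> bounded_maps_norm \<Lambda> \<Lambda> (K x x) * nrm \<Lambda> \<xi> * nrm \<Lambda> \<xi>"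
    using L.bounded_maps_norm_bound[OF K_bounded[OF x x] \<xi>] \<xi> by (intro mult_right_mono) simp_all
  finally show "(nrm \<B> (k x \<xi>))\<^sup>2 \<le> (sqrt (bounded_maps_norm \<Lambda> \<Lambda> (K x x)) * nrm \<Lambda> \<xi>)\<^sup>2"
    using L.bounded_maps_norm_nonneg[OF K_bounded[OF x x]] by (simp add: power_mult_distrib) (simp add: power2_eq_square mult.assoc)
qed (use L.bounded_maps_norm_nonneg[OF K_bounded[OF x x]] \<xi> in simp)

text \<open>The norm of \<open>K x y \<xi>\<close> is found by pairing it with itself, that is, with
  \<eta> = \<open>K x y \<xi>\<close> in the kernel identity; one factor
  \<open>nrm \<Lambda> \<eta>\<close> then cancels.\<close>

lemma bounded_maps_norm_K_le:
  assumes x: "x \<in> X" and y: "y \<in> X"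
  shows "bounded_maps_norm \<Lambda> \<Lambda> (K x y) \<le>
    sqrt (bounded_maps_norm \<Lambda> \<Lambda> (K x x)) * sqrt (bounded_maps_norm \<Lambda> \<Lambda> (K y y))"
proof (rule bounded_maps_norm_le)
  show "0 \<le> sqrt (bounded_maps_norm \<Lambda> \<Lambda> (K x x)) * sqrt (bounded_maps_norm \<Lambda> \<Lambda> (K y y))"
    using L.bounded_maps_norm_nonneg[OF K_bounded[OF x x]] L.bounded_maps_norm_nonneg[OF K_bounded[OF y y]]
    by simp
  fix \<xi>
  assume \<xi>: "\<xi> \<in> carrier \<Lambda>"
  let ?\<eta> = "K x y \<xi>" and ?a = "sqrt (bounded_maps_norm \<Lambda> \<Lambda> (K x x))"
    and ?b = "sqrt (bounded_maps_norm \<Lambda> \<Lambda> (K y y))"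
  have \<eta>: "?\<eta> \<in> carrier \<Lambda>"
    by (rule K_mem[OF x y \<xi>])
  have ge0: "0 \<le> ?a" "0 \<le> ?b"
    using L.bounded_maps_norm_nonneg[OF K_bounded[OF x x]] L.bounded_maps_norm_nonneg[OF K_bounded[OF y y]]
    by simp_all
  show "nrm \<Lambda> ?\<eta> \<le> ?a * ?b * nrm \<Lambda> \<xi>"
  proof (cases "?\<eta> = 0")
    case False
    have "nrm \<Lambda> ?\<eta> * nrm \<Lambda> ?\<eta> = cmod (sip \<B> (k x \<xi>) (k y ?\<eta>))"
      unfolding sip_K[OF x y \<xi> \<eta>, symmetric] L.sip_self[OF \<eta>] by (simp add: norm_mult power2_eq_square)
    also have "\<dots> \<le> nrm \<B> (k x \<xi>) * nrm \<B> (k y ?\<eta>)"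
      by (intro B.sip_bound k_mem x y \<xi> \<eta>)
    also have "\<dots> \<le> (?a * nrm \<Lambda> \<xi>) * (?b * nrm \<Lambda> ?\<eta>)"
      using ge0 \<xi> \<eta> x y by (intro mult_mono nrm_k_le) (simp_all add: k_mem)
    finally have "nrm \<Lambda> ?\<eta> * nrm \<Lambda> ?\<eta> \<le> (?a * ?b * nrm \<Lambda> \<xi>) * nrm \<Lambda> ?\<eta>"
      by (simp add: mult_ac)
    then show ?thesis
      using L.nrm_pos[OF \<eta> False] by simp
  qed (use ge0 \<xi> in simp)
qed

section \<open>Kernel sections and their functionals\<close>

lemma sip_right_cancel:
  assumes "f \<in> carrier \<B>" "g \<in> carrier \<B>" "\<And>h. h \<in> carrier \<B> \<Longrightarrow> sip \<B> h f = sip \<B> h g"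
  shows "f = g"
proof (rule inj_onD[OF B.inj_on_duality_map])
  show "duality_map \<B> f = duality_map \<B> g"
    using assms(3) by (auto simp: duality_map_def restrict0_def)
qed (use assms in simp_all)

text \<open>\<open>K x y\<close> is merely a bounded map, so homogeneity is inherited from the
  semi-inner products: both sides pair with every \<open>h\<close> to \<open>cnj \<alpha>\<close>
  times \<open>[h x, \<xi>]\<close>.\<close>

lemma k_scale:
  assumes x: "x \<in> X" and \<xi>: "\<xi> \<in> carrier \<Lambda>"
  shows "k x (\<alpha> *\<^sub>C \<xi>) = \<alpha> *\<^sub>C k x \<xi>"
  by (rule sip_right_cancel)
    (use x \<xi> in \<open>simp_all add: k_mem reproducing eval_mem L.sip_scale_right B.sip_scale_right\<close>)

text \<open>The reproducing property, read as an identity of functionals, says that the adjoint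
  sends the functional of \<xi> to that of \<open>k x \<xi>\<close>; injectivity makes
  \<open>inv_into\<close> return this preimage.\<close>

lemma k_eq_duality_map_inv:
  assumes x: "x \<in> X" and \<xi>: "\<xi> \<in> carrier \<Lambda>"
  shows "k x \<xi> = duality_map_inv \<B> (adjoint_map \<B> \<Lambda> (point_eval \<B> x) (duality_map \<Lambda> \<xi>))"
proof -
  have "adjoint_map \<B> \<Lambda> (point_eval \<B> x) (duality_map \<Lambda> \<xi>) = duality_map \<B> (k x \<xi>)"
    using x \<xi> L.duality_map_mem[OF \<xi>]
    by (auto simp: adjoint_map_def restrict0_def point_eval_def duality_map_def fun_eq_iff
        reproducing eval_mem)
  then show ?thesis
    using B.inj_on_duality_map k_mem[OF x \<xi>] by (simp add: duality_map_inv_def)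
qed

text \<open>Pairing \<open>f\<close> with \<open>k x (f x)\<close> yields the squared norm of
  \<open>f x\<close>, hence an explicit bound. It makes the supremum defining the norm of
  \<open>point_eval \<B> x\<close> one over a bounded set.\<close>

lemma point_eval_mem:
  assumes x: "x \<in> X"
  shows "point_eval \<B> x \<in> carrier (bounded_ops \<B> \<Lambda>)"
proof -
  let ?a = "sqrt (bounded_maps_norm \<Lambda> \<Lambda> (K x x))"
  have a: "0 \<le> ?a"
    using L.bounded_maps_norm_nonneg[OF K_bounded[OF x x]] by simp
  have "nrm \<Lambda> (f x) \<le> ?a * nrm \<B> f" if f: "f \<in> carrier \<B>" for f
  proof (cases "f x = 0")
    case False
    have fx: "f x \<in> carrier \<Lambda>"
      by (rule eval_mem[OF f x])
    have "nrm \<Lambda> (f x) * nrm \<Lambda> (f x) = cmod (sip \<B> f (k x (f x)))"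
      using reproducing[OF x fx f] L.sip_self[OF fx] by (simp add: norm_mult power2_eq_square)
    also have "\<dots> \<le> nrm \<B> f * nrm \<B> (k x (f x))"
      by (intro B.sip_bound k_mem f x fx)
    also have "\<dots> \<le> nrm \<B> f * (?a * nrm \<Lambda> (f x))"
      using f by (intro mult_left_mono nrm_k_le x fx) simp
    finally have "nrm \<Lambda> (f x) * nrm \<Lambda> (f x) \<le> (?a * nrm \<B> f) * nrm \<Lambda> (f x)"
      by (simp add: mult_ac)
    then show ?thesis
      using L.nrm_pos[OF fx False] by simp
  qed (use a f in simp)
  then have "\<exists>\<alpha>\<ge>0. \<forall>f\<in>carrier \<B>. nrm \<Lambda> (f x) \<le> \<alpha> * nrm \<B> f"
    using a by blast
  moreover have "(\<alpha> *\<^sub>C f) x = \<alpha> *\<^sub>C f x" for \<alpha> and f :: "'x \<Rightarrow> 'l"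
    by (simp add: scaleC_fun_def)
  ultimately show ?thesis
    using x by (simp add: mem_bounded_ops point_eval_def restrict0_def eval_mem)
qed

text \<open>Evaluation at \<open>x\<close> is tested on the section itself: its squared norm is
  \<open>[K x x \<xi>, \<xi>]\<close>, and one factor cancels.\<close>

lemma nrm_k_le_point_eval:
  assumes x: "x \<in> X" and \<xi>: "\<xi> \<in> carrier \<Lambda>"
  shows "nrm \<B> (k x \<xi>) \<le> nrm (bounded_ops \<B> \<Lambda>) (point_eval \<B> x) * nrm \<Lambda> \<xi>"
proof (cases "k x \<xi> = 0")
  case True
  have "normed_space (bounded_ops \<B> \<Lambda>)"
    by (intro normed_pair.normed_space_bounded_ops normed_pair.intro
        B.complex_normed_axioms L.complex_normed_axioms)
  then show ?thesis
    using True \<xi> point_eval_mem[OF x] by (simp add: normed_space_def)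
next
  case False
  let ?N = "nrm (bounded_ops \<B> \<Lambda>) (point_eval \<B> x)"
  note k = k_mem[OF x \<xi>]
  have "nrm \<Lambda> (K x x \<xi>) \<le> ?N * nrm \<B> (k x \<xi>)"
    using normed_pair.bounded_ops_bound[OF normed_pair.intro[OF B.complex_normed_axioms L.complex_normed_axioms]
        point_eval_mem[OF x] k] k x
    by (simp add: point_eval_def restrict0_def k_apply)
  moreover have "nrm \<B> (k x \<xi>) * nrm \<B> (k x \<xi>) \<le> nrm \<Lambda> (K x x \<xi>) * nrm \<Lambda> \<xi>"
    using L.sip_bound[OF K_mem[OF x x \<xi>] \<xi>] by (simp add: sip_K_self[OF x \<xi>] norm_mult power2_eq_square)
  ultimately have "nrm \<B> (k x \<xi>) * nrm \<B> (k x \<xi>) \<le> (?N * nrm \<B> (k x \<xi>)) * nrm \<Lambda> \<xi>"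
    using \<xi> by (meson L.nrm_nonneg mult_right_mono order_trans)
  then have "nrm \<B> (k x \<xi>) * nrm \<B> (k x \<xi>) \<le> (?N * nrm \<Lambda> \<xi>) * nrm \<B> (k x \<xi>)"
    by (simp add: mult_ac)
  then show ?thesis
    using B.nrm_pos[OF k False] by simp
qed

text \<open>The functional of \<open>k x \<xi>\<close> is that of \<xi> composed with evaluation at
  \<open>x\<close>, and this composition preserves sums although the duality mapping itself need not
  be additive.\<close>

lemma duality_map_k_add:
  assumes "x \<in> X" "\<xi> \<in> carrier \<Lambda>" "\<eta> \<in> carrier \<Lambda>" "\<tau> \<in> carrier \<Lambda>"
    and "duality_map \<Lambda> \<tau> = duality_map \<Lambda> \<xi> + duality_map \<Lambda> \<eta>"
  shows "duality_map \<B> (k x \<xi>) + duality_map \<B> (k x \<eta>) = duality_map \<B> (k x \<tau>)"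
proof -
  have "sip \<Lambda> u \<tau> = sip \<Lambda> u \<xi> + sip \<Lambda> u \<eta>" if "u \<in> carrier \<Lambda>" for u
    using fun_cong[OF assms(5), of u] that by simp
  then show ?thesis
    using assms by (auto simp: duality_map_def restrict0_def fun_eq_iff reproducing eval_mem)
qed

lemma span_duality_map_k_dense:
  "nspace_topology (dual \<B>) closure_of
      complex_vector.span {duality_map \<B> (k x \<xi>) | x \<xi>. x \<in> X \<and> \<xi> \<in> carrier \<Lambda>} = carrier (dual \<B>)"
proof (rule B.dual_dense_if_separating)
  let ?S = "{duality_map \<B> (k x \<xi>) | x \<xi>. x \<in> X \<and> \<xi> \<in> carrier \<Lambda>}"
  show "complex_vector.subspace (complex_vector.span ?S)"
    by (rule complex_vector.subspace_span)
  show "complex_vector.span ?S \<subseteq> carrier (dual \<B>)"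
    by (rule complex_vector.span_minimal)
      (auto intro: B.duality_map_mem k_mem complex_normed.subspace_carrier[OF B.complex_normed_dual])
  fix f
  assume f: "f \<in> carrier \<B>" and zero: "\<And>m. m \<in> complex_vector.span ?S \<Longrightarrow> m f = 0"
  have "f x = 0" if x: "x \<in> X" for x
  proof -
    have fx: "f x \<in> carrier \<Lambda>"
      by (rule eval_mem[OF f x])
    then have "duality_map \<B> (k x (f x)) f = 0"
      using x by (intro zero complex_vector.span_base) auto
    then have "sip \<Lambda> (f x) (f x) = 0"
      using f by (simp add: reproducing[OF x fx])
    then show ?thesis
      using L.sip_self[OF fx] fx by simp
  qed
  then show "f = 0"
    using eq_0_iff[OF f] by blast
qed

end

theorem proposition2p4:
  fixes X :: "'x set"
    and \<Lambda> :: "'l::complex_vector nspace"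
    and \<B> :: "('x \<Rightarrow> 'l) nspace"
    and K :: "'x \<Rightarrow> 'x \<Rightarrow> 'l \<Rightarrow> 'l"
  assumes "uniform_banach_space \<Lambda>"
    and "rkbs X \<Lambda> \<B>"
    and "reproducing_kernel X \<Lambda> \<B> K"
  shows
    "(\<forall>x\<in>X. \<forall>y\<in>X. \<forall>\<xi>\<in>carrier \<Lambda>. \<forall>\<eta>\<in>carrier \<Lambda>.
        sip \<Lambda> (K x x \<xi>) \<xi> \<in> \<real>\<^sub>\<ge>\<^sub>0 \<and>
        cmod (sip \<Lambda> (K x y \<xi>) \<eta>) \<le>
          sqrt (Re (sip \<Lambda> (K x x \<xi>) \<xi>)) * sqrt (Re (sip \<Lambda> (K y y \<eta>) \<eta>))) \<and>
     (\<forall>x\<in>X. \<forall>y\<in>X.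
        bounded_maps_norm \<Lambda> \<Lambda> (K x y) \<le>
          sqrt (bounded_maps_norm \<Lambda> \<Lambda> (K x x)) * sqrt (bounded_maps_norm \<Lambda> \<Lambda> (K y y))) \<and>
     (\<forall>x\<in>X. \<forall>\<xi>\<in>carrier \<Lambda>.
        kernel_section X K x \<xi> =
          duality_map_inv \<B> (adjoint_map \<B> \<Lambda> (point_eval \<B> x) (duality_map \<Lambda> \<xi>))) \<and>
     (\<forall>x\<in>X. \<forall>y\<in>X. \<forall>\<xi>\<in>carrier \<Lambda>. \<forall>\<alpha>::complex.
        K x y (\<alpha> *\<^sub>C \<xi>) = \<alpha> *\<^sub>C K x y \<xi>) \<and>
     (\<forall>x\<in>X. \<forall>\<xi>\<in>carrier \<Lambda>.
        nrm \<B> (kernel_section X K x \<xi>) \<le> nrm (bounded_ops \<B> \<Lambda>) (point_eval \<B> x) * nrm \<Lambda> \<xi> \<and>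
        nrm \<B> (kernel_section X K x \<xi>) \<le> sqrt (bounded_maps_norm \<Lambda> \<Lambda> (K x x)) * nrm \<Lambda> \<xi>) \<and>
     (\<forall>x\<in>X. \<forall>\<xi>\<in>carrier \<Lambda>. \<forall>\<eta>\<in>carrier \<Lambda>. \<forall>\<tau>\<in>carrier \<Lambda>.
        duality_map \<Lambda> \<tau> = duality_map \<Lambda> \<xi> + duality_map \<Lambda> \<eta> \<longrightarrow>
        duality_map \<B> (kernel_section X K x \<xi>) + duality_map \<B> (kernel_section X K x \<eta>) =
          duality_map \<B> (kernel_section X K x \<tau>)) \<and>
     nspace_topology (dual \<B>) closure_of
        complex_vector.span {duality_map \<B> (kernel_section X K x \<xi>) | x \<xi>. x \<in> X \<and> \<xi> \<in> carrier \<Lambda>} =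
      carrier (dual \<B>)"
proof -
  interpret kernel X \<Lambda> \<B> K
    by (rule kernel.intro) (fact assms)+
  have nonneg: "sip \<Lambda> (K x x \<xi>) \<xi> \<in> \<real>\<^sub>\<ge>\<^sub>0" if "x \<in> X" "\<xi> \<in> carrier \<Lambda>" for x \<xi>
    unfolding sip_K_self[OF that] by (simp del: of_real_power)
  have scale: "K x y (\<alpha> *\<^sub>C \<xi>) = \<alpha> *\<^sub>C K x y \<xi>" if "x \<in> X" "y \<in> X" "\<xi> \<in> carrier \<Lambda>" for x y \<xi> \<alpha>
    using fun_cong[OF k_scale[OF that(1,3)], of \<alpha> y] that(2) by (simp add: k_apply scaleC_fun_def)
  show ?thesis
    by (intro conjI ballI allI impI nonneg cmod_sip_K_le bounded_maps_norm_K_le k_eq_duality_map_inv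
        scale nrm_k_le_point_eval nrm_k_le duality_map_k_add span_duality_map_k_dense)
qed

end
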